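(* For every integer $d\geq 4$ and every integer $k\geq 2$, the generic $d$-dimensional rigidity matroid $\mathcal{R}_d$ does not have the $k$-fold circuit property; that is, there exists a positive integer $n$ such that $\mathcal{R}_d(K_n)$ (the generic $d$-dimensional rigidity matroid on the edge set of the complete graph $K_n$) has a $k$-fold circuit which is not balanced.
   Context: Let $\mathcal{M}=(E,r)$ be a matroid on a finite set $E$ with rank function $r$ and closure operator $\mathrm{cl}(X)=\{x\in E: r(X\cup\{x\})=r(X)\}$. A set $D\subseteq E$ is cyclic if it is a union of circuits (equivalently $r(D-e)=r(D)$ for all $e\in D$). For an integer $k\geq 0$, a $k$-fold circuit of $\mathcal{M}$ is a cyclic set $D$ with $r(D)=|D|-k$. If $D$ is a $k$-fold circuit with $k\ge1$, its principal partition is the partition $\{A_1,\dots,A_\ell\}$ of $D$ such that $\{D\setminus A_i: 1\le i\le \ell\}$ is exactly the set of all $(k-1)$-fold circuits of $\mathcal{M}$ contained in $D$. A $k$-fold circuit $D$ with principal partition $\{A_1,\dots,A_\ell\}$ is balanced if $r\big(\bigcap_{i=1}^\ell \mathrm{cl}(D\setminus A_i)\big)=\ell-k$. A matroid has the $k$-fold circuit property if all its $k$-fold circuits are balanced. For a graph $G=(V,E)$ and a generic $p:V\to\mathbb{R}^d$ (coordinates algebraically independent over $\mathbb{Q}$), the rigidity matrix $R(G,p)$ is the $|E|\times d|V|$ matrix whose row for $uv\in E$ has $p(u)-p(v)$ in the $d$ columns of $u$, $p(v)-p(u)$ in the $d$ columns of $v$, and zeros elsewhere. The generic $d$-dimensional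 rigidity matroid $\mathcal{R}_d(G)$ is the row matroid of $R(G,p)$ on $E$ (independent of the generic choice of $p$). $\mathcal{R}_d$ refers to the family $\mathcal{R}_d(K_n)$, $n\ge1$. *)

theory Defs
  imports Complex_Main
begin

definition mclosure :: "('a set \<Rightarrow> nat) \<Rightarrow> 'a set \<Rightarrow> 'a set \<Rightarrow> 'a set" where
  "mclosure r E X = {x \<in> E. r (insert x X) = r X}"

definition cyclic_set :: "('a set \<Rightarrow> nat) \<Rightarrow> 'a set \<Rightarrow> bool" where
  "cyclic_set r D \<longleftrightarrow> (\<forall>e\<in>D. r (D - {e}) = r D)"

definition kfold_circuit :: "('a set \<Rightarrow> nat) \<Rightarrow> 'a set \<Rightarrow> nat \<Rightarrow> 'a set \<Rightarrow> bool" where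
  "kfold_circuit r E k D \<longleftrightarrow>
     D \<subseteq> E \<and> finite D \<and> cyclic_set r D \<and> int (r D) = int (card D) - int k"

definition principal_partition ::
  "('a set \<Rightarrow> nat) \<Rightarrow> 'a set \<Rightarrow> nat \<Rightarrow> 'a set \<Rightarrow> 'a set set \<Rightarrow> bool" where
  "principal_partition r E k D P \<longleftrightarrow>
     (\<forall>A\<in>P. A \<noteq> {} \<and> A \<subseteq> D) \<and> \<Union>P = D \<and>
     (\<forall>A\<in>P. \<forall>B\<in>P. A \<noteq> B \<longrightarrow> A \<inter> B = {}) \<and>
     (\<lambda>A. D - A) ` P = {C. C \<subseteq> D \<and> kfold_circuit r E (k - 1) C}"

definition balanced :: "('a set \<Rightarrow> nat) \<Rightarrow> 'a set \<Rightarrow> nat \<Rightarrow> 'a set \<Rightarrow> bool" where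
  "balanced r E k D \<longleftrightarrow>
     (\<forall>P. principal_partition r E k D P \<longrightarrow>
        int (r (\<Inter>A\<in>P. mclosure r E (D - A))) = int (card P) - int k)"

text \<open>A point configuration of K_n in R^d: p v j is the j-th coordinate of vertex v
  (only v < n, j < d matter).\<close>

definition coord_index :: "nat \<Rightarrow> nat \<Rightarrow> (nat \<times> nat) set" where
  "coord_index d n = {0..<n} \<times> {0..<d}"

text \<open>Algebraic independence over Q of the family x indexed by a finite set I:
  no nonzero rational polynomial in the variables x_i (i in I) vanishes at x.
  A polynomial is a finitely supported map c from monomials (exponent vectors
  supported in I) to rationals.\<close>
definition alg_indep_Q :: "'i set \<Rightarrow> ('i \<Rightarrow> real) \<Rightarrow> bool" where
  "alg_indep_Q I x \<longleftrightarrow>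
     (\<forall>c :: ('i \<Rightarrow> nat) \<Rightarrow> rat.
        finite {m. c m \<noteq> 0} \<longrightarrow>
        (\<forall>m. c m \<noteq> 0 \<longrightarrow> (\<forall>i. i \<notin> I \<longrightarrow> m i = 0)) \<longrightarrow>
        (\<Sum>m\<in>{m. c m \<noteq> 0}. of_rat (c m) * (\<Prod>i\<in>I. x i ^ m i)) = 0 \<longrightarrow>
        (\<forall>m. c m = 0))"

definition generic_config :: "nat \<Rightarrow> nat \<Rightarrow> (nat \<Rightarrow> nat \<Rightarrow> real) \<Rightarrow> bool" where
  "generic_config d n p \<longleftrightarrow> alg_indep_Q (coord_index d n) (\<lambda>(v, j). p v j)"

definition Kn_edges :: "nat \<Rightarrow> nat set set" where
  "Kn_edges n = {{u, v} | u v. u < n \<and> v < n \<and> u \<noteq> v}"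

definition rigidity_row :: "nat \<Rightarrow> (nat \<Rightarrow> nat \<Rightarrow> real) \<Rightarrow> nat set \<Rightarrow> nat \<times> nat \<Rightarrow> real" where
  "rigidity_row d p e = (\<lambda>(w, j).
     if j < d \<and> w \<in> e then (\<Sum>u\<in>e - {w}. p w j - p u j) else 0)"

definition lin_indep_family :: "'e set \<Rightarrow> ('e \<Rightarrow> 'i \<Rightarrow> real) \<Rightarrow> bool" where
  "lin_indep_family F vec \<longleftrightarrow>
     (\<forall>c :: 'e \<Rightarrow> real. (\<forall>i. (\<Sum>e\<in>F. c e * vec e i) = 0) \<longrightarrow> (\<forall>e\<in>F. c e = 0))"

definition row_rank :: "nat \<Rightarrow> (nat \<Rightarrow> nat \<Rightarrow> real) \<Rightarrow> nat set set \<Rightarrow> nat" where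
  "row_rank d p X = Max (card ` {Y. Y \<subseteq> X \<and> finite Y \<and> lin_indep_family Y (rigidity_row d p)})"

text \<open>The generic d-dimensional rigidity matroid R_d(K_n): row matroid of R(K_n,p) for a
  generic p (it does not depend on the generic choice).\<close>
definition generic_rigidity_rank :: "nat \<Rightarrow> nat \<Rightarrow> nat set set \<Rightarrow> nat" where
  "generic_rigidity_rank d n = row_rank d (SOME p. generic_config d n p)"

end

theory Submission
  imports Defs "HOL-Computational_Algebra.Polynomial" "HOL-Analysis.Continuum_Not_Denumerable"
    "HOL-Analysis.Finite_Cartesian_Product"
begin

text \<open>The unbalanced circuit is the vertex-disjoint union of the complete bipartite graph
  $K_{d+2,d+3}$ with sides $A$, $B$ and of $k-2$ copies of $K_{d+2}$. Since $2d+5$ is less than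
  $d+2 \choose 2$ for $d \ge 4$, the squares of the generic points of $A$ and $B$ are linearly
  independent, so that every stress of the bipartite part has the form
  $\omega_{ab} = \alpha_a t_b$ with affine dependencies $\alpha$ of $A$ and $t$ of $B$. Hence the
  principal partition consists of the $d+3$ stars of the vertices of $B$ and of the $k-2$ cliques,
  which gives $\ell - k = d+1$. No edge lies in all closures $\mathrm{cl}(D \setminus A_i)$:
  an edge with an end outside $A$ becomes pendant once the part at that end is removed, and an
  edge inside $A$ carries no stress because the product of its ends is independent of the squares.
  So the intersection has rank 0.\<close>

section \<open>Polynomial conditions at generic points\<close>

text \<open>The number (d+2 choose 2) is the dimension of the symmetric (d+1) x (d+1) matrices,
  where the squares of points live; the strict inequality leaves room for one further product. It
  fails at d = 3, where 11 > 10. The count alone does not make generic squares independent, so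
  independence is checked at one explicit position and carried over: a rational polynomial that is
  nonzero somewhere is nonzero at algebraically independent coordinates. The sizes d+2 and d+3 give
  \<open>A\<close> a one-dimensional and \<open>B\<close> a two-dimensional space of affine
  dependencies, so the bipartite part has a two-dimensional space of stresses and accounts for k =
  2. Each further clique carries one stress and forms one part, so it raises k and l together and
  leaves l - k unchanged. The rank function refers to a configuration picked by \<open>SOME\<close>,
  so nothing is known about it until generic configurations are shown to exist.\<close>

inductive_set polyfun :: "'i set \<Rightarrow> (('i \<Rightarrow> real) \<Rightarrow> real) set" for I where
  const: "(\<lambda>x. of_rat q) \<in> polyfun I"
| var: "i \<in> I \<Longrightarrow> (\<lambda>x. x i) \<in> polyfun I"
| add: "f \<in> polyfun I \<Longrightarrow> g \<in> polyfun I \<Longrightarrow> (\<lambda>x. f x + g x) \<in> polyfun I"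
| mult: "f \<in> polyfun I \<Longrightarrow> g \<in> polyfun I \<Longrightarrow> (\<lambda>x. f x * g x) \<in> polyfun I"

lemma polyfun_0: "(\<lambda>x. 0) \<in> polyfun I"
  using polyfun.const[of 0] by simp

lemma polyfun_1: "(\<lambda>x. 1) \<in> polyfun I"
  using polyfun.const[of 1] by simp

lemma polyfun_diff:
  assumes "f \<in> polyfun I" "g \<in> polyfun I"
  shows "(\<lambda>x. f x - g x) \<in> polyfun I"
proof -
  have "(\<lambda>x. f x + of_rat (- 1) * g x) \<in> polyfun I"
    using assms by (intro polyfun.intros)
  then show ?thesis by (simp add: of_rat_minus)
qed

lemma polyfun_sum:
  "(\<And>j. j \<in> J \<Longrightarrow> f j \<in> polyfun I) \<Longrightarrow> (\<lambda>x. \<Sum>j\<in>J. f j x) \<in> polyfun I"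
  by (induction J rule: infinite_finite_induct) (auto intro: polyfun.add polyfun_0)

lemma sum_list_product:
  fixes f g h :: "'b \<Rightarrow> 'a::comm_semiring_0"
  assumes "\<And>u v. h (t u v) = f u * g v"
  shows "sum_list (map h (concat (map (\<lambda>u. map (t u) ys) xs))) =
    sum_list (map f xs) * sum_list (map g ys)"
  by (induction xs) (simp_all add: assms comp_def distrib_right sum_list_const_mult)

text \<open>Lists of coefficient-monomial pairs may repeat a monomial, so sums become concatenations
  and products become lists of all pairwise products. Equal monomials are merged only afterwards, by
  \<open>sum_collect_terms\<close>.\<close>

lemma polyfun_expand:
  assumes "finite I" "f \<in> polyfun I"
  shows "\<exists>L :: (rat \<times> ('i \<Rightarrow> nat)) list. (\<forall>t\<in>set L. \<forall>i. i \<notin> I \<longrightarrow> snd t i = 0) \<and>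
    (\<forall>x. f x = (\<Sum>t\<leftarrow>L. of_rat (fst t) * (\<Prod>i\<in>I. x i ^ snd t i)))"
  using assms(2)
proof induction
  case (const q)
  show ?case by (rule exI[of _ "[(q, \<lambda>_. 0)]"]) simp
next
  case (var i)
  have "(\<Prod>j\<in>I. x j ^ (if j = i then 1 else 0)) = x i" for x :: "'i \<Rightarrow> real"
    using var assms(1) by (simp add: if_distrib[of "\<lambda>e. _ ^ e"] prod.delta cong: if_cong)
  then show ?case
    using var by (intro exI[of _ "[(1, \<lambda>j. if j = i then 1 else 0)]"]) auto
next
  case (add f g)
  from add.IH(1) obtain L :: "(rat \<times> ('i \<Rightarrow> nat)) list" where L:
    "\<forall>t\<in>set L. \<forall>i. i \<notin> I \<longrightarrow> snd t i = 0"
    "\<And>x. f x = (\<Sum>t\<leftarrow>L. of_rat (fst t) * (\<Prod>i\<in>I. x i ^ snd t i))"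
    by blast
  from add.IH(2) obtain M :: "(rat \<times> ('i \<Rightarrow> nat)) list" where M:
    "\<forall>t\<in>set M. \<forall>i. i \<notin> I \<longrightarrow> snd t i = 0"
    "\<And>x. g x = (\<Sum>t\<leftarrow>M. of_rat (fst t) * (\<Prod>i\<in>I. x i ^ snd t i))"
    by blast
  show ?case using L M by (intro exI[of _ "L @ M"]) auto
next
  case (mult f g)
  from mult.IH(1) obtain L :: "(rat \<times> ('i \<Rightarrow> nat)) list" where L:
    "\<forall>t\<in>set L. \<forall>i. i \<notin> I \<longrightarrow> snd t i = 0"
    "\<And>x. f x = (\<Sum>t\<leftarrow>L. of_rat (fst t) * (\<Prod>i\<in>I. x i ^ snd t i))"
    by blast
  from mult.IH(2) obtain M :: "(rat \<times> ('i \<Rightarrow> nat)) list" where M: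
    "\<forall>t\<in>set M. \<forall>i. i \<notin> I \<longrightarrow> snd t i = 0"
    "\<And>x. g x = (\<Sum>t\<leftarrow>M. of_rat (fst t) * (\<Prod>i\<in>I. x i ^ snd t i))"
    by blast
  define t :: "rat \<times> ('i \<Rightarrow> nat) \<Rightarrow> _" where
    "t = (\<lambda>u v. (fst u * fst v :: rat, \<lambda>i. snd u i + snd v i :: nat))"
  have "f x * g x = (\<Sum>t\<leftarrow>concat (map (\<lambda>u. map (t u) M) L).
      of_rat (fst t) * (\<Prod>i\<in>I. x i ^ snd t i))" for x
    unfolding L(2) M(2)
    by (rule sum_list_product[symmetric])
      (simp add: t_def of_rat_mult power_add prod.distrib)
  moreover have "\<forall>u\<in>set (concat (map (\<lambda>u. map (t u) M) L)). \<forall>i. i \<notin> I \<longrightarrow> snd u i = 0"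
    using L(1) M(1) by (auto simp: t_def)
  ultimately show ?case by blast
qed

lemma sum_list_neutral: "(\<And>t. t \<in> set L \<Longrightarrow> f t = 0) \<Longrightarrow> sum_list (map f L) = (0::'a::monoid_add)"
  by (induction L) auto

lemma sum_collect_terms:
  fixes L :: "(rat \<times> 'm) list" and g :: "'m \<Rightarrow> real"
  assumes "finite S" "snd ` set L \<subseteq> S"
  shows "(\<Sum>m\<in>S. of_rat (\<Sum>t\<leftarrow>L. if snd t = m then fst t else 0) * g m) =
    (\<Sum>t\<leftarrow>L. of_rat (fst t) * g (snd t))"
  using assms(2)
proof (induction L)
  case (Cons t L)
  have "(\<Sum>m\<in>S. of_rat (if snd t = m then fst t else 0) * g m) =
      (\<Sum>m\<in>S. if snd t = m then of_rat (fst t) * g m else 0)"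
    by (rule sum.cong) auto
  also have "\<dots> = of_rat (fst t) * g (snd t)"
    using Cons.prems assms(1) by simp
  finally show ?case using Cons by (simp add: of_rat_add distrib_right sum.distrib)
qed simp

text \<open>A vanishing value at \<open>x\<close> kills all coefficients, hence the function. It is
  applied in the contrapositive: one special point \<open>y\<close> with a nonzero value certifies a
  nonzero value at the generic \<open>x\<close>.\<close>

lemma alg_indep_polyfun_eq_0:
  assumes "finite I" "alg_indep_Q I x" "f \<in> polyfun I" "f x = 0"
  shows "f y = 0"
proof -
  obtain L :: "(rat \<times> ('a \<Rightarrow> nat)) list" where
    L: "\<forall>t\<in>set L. \<forall>i. i \<notin> I \<longrightarrow> snd t i = 0"
    and f: "\<And>x. f x = (\<Sum>t\<leftarrow>L. of_rat (fst t) * (\<Prod>i\<in>I. x i ^ snd t i))"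
    using polyfun_expand[OF assms(1,3)] by auto
  define c where "c m = (\<Sum>t\<leftarrow>L. if snd t = m then fst t else 0)" for m
  have sub: "{m. c m \<noteq> 0} \<subseteq> snd ` set L"
  proof
    fix m assume "m \<in> {m. c m \<noteq> 0}"
    then have "\<exists>t\<in>set L. (if snd t = m then fst t else 0) \<noteq> 0"
      using sum_list_neutral[of L "\<lambda>t. if snd t = m then fst t else 0"] unfolding c_def by blast
    then show "m \<in> snd ` set L" by (auto split: if_splits)
  qed
  have fc: "f z = (\<Sum>m\<in>{m. c m \<noteq> 0}. of_rat (c m) * (\<Prod>i\<in>I. z i ^ m i))" for z
  proof -
    have "f z = (\<Sum>m\<in>snd ` set L. of_rat (c m) * (\<Prod>i\<in>I. z i ^ m i))"
      unfolding f c_def by (rule sum_collect_terms[symmetric]) auto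
    also have "\<dots> = (\<Sum>m\<in>{m. c m \<noteq> 0}. of_rat (c m) * (\<Prod>i\<in>I. z i ^ m i))"
      using sub by (intro sum.mono_neutral_right) auto
    finally show ?thesis .
  qed
  have "finite {m. c m \<noteq> 0}" using sub finite_subset by blast
  moreover have "\<forall>m. c m \<noteq> 0 \<longrightarrow> (\<forall>i. i \<notin> I \<longrightarrow> m i = 0)"
    using sub L by fastforce
  ultimately have "\<forall>m. c m = 0"
    using assms(2,4) unfolding alg_indep_Q_def fc by blast
  then show ?thesis by (simp add: fc)
qed

lemma lin_indep_familyD:
  "lin_indep_family F v \<Longrightarrow> (\<And>i. (\<Sum>e\<in>F. c e * v e i) = 0) \<Longrightarrow> e \<in> F \<Longrightarrow> c e = 0"
  unfolding lin_indep_family_def by blast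

lemma lin_indep_familyI:
  "(\<And>c e. (\<And>i. (\<Sum>e\<in>F. c e * v e i) = 0) \<Longrightarrow> e \<in> F \<Longrightarrow> c e = 0) \<Longrightarrow> lin_indep_family F v"
  unfolding lin_indep_family_def by blast

text \<open>Gaussian elimination without division: a pivot that is a nonzero polynomial does not
  vanish at the generic point.\<close>

lemma lin_indep_family_generic:
  assumes "finite I" "alg_indep_Q I x" "finite F"
    and "\<And>e i. e \<in> F \<Longrightarrow> V e i \<in> polyfun I"
    and "lin_indep_family F (\<lambda>e i. V e i y)"
  shows "lin_indep_family F (\<lambda>e i. V e i x)"
  using assms(3-)
proof (induction F arbitrary: V)
  case empty
  then show ?case by (simp add: lin_indep_family_def)
next
  case (insert e F)
  have "\<exists>i. V e i y \<noteq> 0"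
  proof (rule ccontr)
    assume "\<not> ?thesis"
    then have "(\<Sum>f\<in>insert e F. (if f = e then 1 else 0) * V f i y) = 0" for i
      by (intro sum.neutral) auto
    from lin_indep_familyD[OF insert.prems(2) this, of e] show False by simp
  qed
  then obtain i where i: "V e i y \<noteq> 0" by blast
  then have ix: "V e i x \<noteq> 0"
    using alg_indep_polyfun_eq_0[OF assms(1,2)] insert.prems(1) by blast
  define W where "W f j z = V e i z * V f j z - V f i z * V e j z" for f j z
  have sumW: "(\<Sum>f\<in>F. c f * W f j z) =
      (\<Sum>f\<in>F. (V e i z * c f) * V f j z) + (- (\<Sum>f\<in>F. c f * V f i z)) * V e j z"
    for c j z
    by (simp add: W_def sum_subtractf algebra_simps sum_distrib_left)
  have "lin_indep_family F (\<lambda>f j. W f j y)"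
  proof (rule lin_indep_familyI)
    fix c f assume 0: "\<And>j. (\<Sum>f\<in>F. c f * W f j y) = 0" and f: "f \<in> F"
    \<comment> \<open>Lifts a dependency of the reduced rows: the rows of \<open>F\<close> are
      scaled by the pivot, and row \<open>e\<close> receives the coefficient that
      \<open>sumW\<close> prescribes.\<close>
    define c' where "c' g = (if g = e then - (\<Sum>f\<in>F. c f * V f i y) else V e i y * c g)" for g
    have "(\<Sum>g\<in>insert e F. c' g * V g j y) = 0" for j
    proof -
      have "(\<Sum>g\<in>F. c' g * V g j y) = (\<Sum>f\<in>F. (V e i y * c f) * V f j y)"
        using insert.hyps by (intro sum.cong) (auto simp: c'_def)
      then show ?thesis
        using 0[of j] insert.hyps unfolding sumW by (simp add: c'_def)
    qed
    from lin_indep_familyD[OF insert.prems(2) this, of f] show "c f = 0"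
      using f i insert.hyps by (auto simp: c'_def split: if_splits)
  qed
  moreover have "W f j \<in> polyfun I" if "f \<in> F" for f j
  proof -
    have "W f j = (\<lambda>z. V e i z * V f j z - V f i z * V e j z)"
      by (simp add: W_def fun_eq_iff)
    moreover have "V e i \<in> polyfun I" "V f j \<in> polyfun I" "V f i \<in> polyfun I" "V e j \<in> polyfun I"
      using that by (simp_all add: insert.prems(1))
    ultimately show ?thesis using polyfun_diff[OF polyfun.mult polyfun.mult] by simp
  qed
  ultimately have IH: "lin_indep_family F (\<lambda>f j. W f j x)"
    using insert.IH[of W] by simp
  show ?case
  proof (rule lin_indep_familyI)
    fix c g assume 0: "\<And>j. (\<Sum>f\<in>insert e F. c f * V f j x) = 0" and g: "g \<in> insert e F"
    have eq: "(\<Sum>f\<in>F. c f * V f j x) = - c e * V e j x" for j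
      using 0[of j] insert.hyps by simp
    have "(\<Sum>f\<in>F. c f * W f j x) = 0" for j
    proof -
      have "(\<Sum>f\<in>F. c f * W f j x) =
          V e i x * (\<Sum>f\<in>F. c f * V f j x) - (\<Sum>f\<in>F. c f * V f i x) * V e j x"
        unfolding sumW by (simp add: sum_distrib_left mult.assoc)
      then show ?thesis unfolding eq by simp
    qed
    then have cF: "c f = 0" if "f \<in> F" for f
      using lin_indep_familyD[OF IH] that by blast
    then have "c e * V e i x = 0" using eq[of i] by simp
    then show "c g = 0" using ix g cF by auto
  qed
qed

section \<open>Existence of generic configurations\<close>

lemma countable_finite_support_functions:
  assumes "finite I"
  shows "countable {m :: 'i \<Rightarrow> nat. \<forall>i. i \<notin> I \<longrightarrow> m i = 0}" (is "countable ?M")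
proof (rule countable_image_inj_on)
  show "inj_on (\<lambda>m. restrict m I) ?M"
  proof (rule inj_onI, rule ext)
    fix m m' i assume "m \<in> ?M" "m' \<in> ?M" "restrict m I = restrict m' I"
    then show "m i = m' i" by (cases "i \<in> I") (auto dest: fun_cong[of _ _ i])
  qed
  show "countable ((\<lambda>m. restrict m I) ` ?M)"
  proof (rule countable_subset)
    show "(\<lambda>m. restrict m I) ` ?M \<subseteq> PiE I (\<lambda>_. UNIV)" by auto
    show "countable (PiE I (\<lambda>_. UNIV :: nat set))"
      using assms by (rule countable_PiE) simp
  qed
qed

text \<open>A polynomial is determined by the graph of its nonzero coefficients, a finite subset of
  a countable set.\<close>

lemma countable_polynomials:
  assumes "finite I"
  shows "countable {c :: ('i \<Rightarrow> nat) \<Rightarrow> rat. finite {m. c m \<noteq> 0} \<and>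
    (\<forall>m. c m \<noteq> 0 \<longrightarrow> (\<forall>i. i \<notin> I \<longrightarrow> m i = 0))}" (is "countable ?P")
proof -
  let ?M = "{m :: 'i \<Rightarrow> nat. \<forall>i. i \<notin> I \<longrightarrow> m i = 0}"
  define G where "G c = {(m, c m) | m. c m \<noteq> 0}" for c :: "('i \<Rightarrow> nat) \<Rightarrow> rat"
  have "countable (?M \<times> (UNIV :: rat set))"
    using countable_finite_support_functions[OF assms] by (intro countable_SIGMA) auto
  then have "countable {X. finite X \<and> X \<subseteq> ?M \<times> (UNIV :: rat set)}"
    by (rule countable_Collect_finite_subset)
  moreover have "G ` ?P \<subseteq> {X. finite X \<and> X \<subseteq> ?M \<times> (UNIV :: rat set)}"
  proof (intro subsetI CollectI conjI; elim imageE)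
    fix X c assume "X = G c" "c \<in> ?P"
    then show "finite X" by (auto simp: G_def setcompr_eq_image)
  qed (auto simp: G_def)
  ultimately have "countable (G ` ?P)" by (rule countable_subset[rotated])
  moreover have "inj_on G ?P"
  proof (rule inj_onI, rule ext)
    fix c c' m assume "G c = G c'"
    moreover have "(m, q) \<in> G b \<longleftrightarrow> b m \<noteq> 0 \<and> q = b m" for q b by (auto simp: G_def)
    ultimately have "c m \<noteq> 0 \<and> q = c m \<longleftrightarrow> c' m \<noteq> 0 \<and> q = c' m" for q by metis
    from this[of "c m"] this[of "c' m"] show "c m = c' m" by auto
  qed
  ultimately show ?thesis by (rule countable_image_inj_on)
qed

lemma alg_indep_QD:
  assumes "alg_indep_Q I x" "finite {m. c m \<noteq> 0}"
    and "\<forall>m. c m \<noteq> 0 \<longrightarrow> (\<forall>i. i \<notin> I \<longrightarrow> m i = 0)"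
    and "(\<Sum>m\<in>{m. c m \<noteq> 0}. of_rat (c m) * (\<Prod>i\<in>I. x i ^ m i)) = 0"
  shows "c m = 0"
  using assms(1)[unfolded alg_indep_Q_def, THEN spec, THEN mp, THEN mp, THEN mp, OF assms(2-4)] ..

text \<open>With \<open>x\<close> substituted for the old variables, every nonzero rational
  polynomial becomes a nonzero real polynomial in \<open>t\<close> and excludes finitely many
  values. There are countably many polynomials and uncountably many reals, so some \<open>t\<close>
  survives.\<close>

lemma alg_indep_Q_extend:
  assumes "finite I" "i0 \<notin> I" "alg_indep_Q I x"
  shows "\<exists>t. alg_indep_Q (insert i0 I) (x(i0 := t))"
proof -
  let ?J = "insert i0 I"
  define Q where "Q = {c :: ('a \<Rightarrow> nat) \<Rightarrow> rat. finite {m. c m \<noteq> 0} \<and>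
    (\<forall>m. c m \<noteq> 0 \<longrightarrow> (\<forall>i. i \<notin> ?J \<longrightarrow> m i = 0))}"
  define q :: "(('a \<Rightarrow> nat) \<Rightarrow> rat) \<Rightarrow> real poly" where
    "q c = (\<Sum>m\<in>{m. c m \<noteq> 0}. monom (of_rat (c m) * (\<Prod>i\<in>I. x i ^ m i)) (m i0))" for c
  have qt: "poly (q c) t = (\<Sum>m\<in>{m. c m \<noteq> 0}. of_rat (c m) * (\<Prod>i\<in>?J. (x(i0 := t)) i ^ m i))"
    for c t
  proof -
    have P: "(\<Prod>i\<in>?J. (x(i0 := t)) i ^ m i) = t ^ m i0 * (\<Prod>i\<in>I. x i ^ m i)" for m
    proof -
      have "(\<Prod>i\<in>I. (x(i0 := t)) i ^ m i) = (\<Prod>i\<in>I. x i ^ m i)"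
        using assms(2) by (intro prod.cong) auto
      then show ?thesis using assms(1,2) by simp
    qed
    show ?thesis
      unfolding q_def poly_sum poly_monom P by (simp only: mult_ac)
  qed
  have qn: "q c \<noteq> 0" if c: "c \<in> Q" "c m0 \<noteq> 0" for c m0
  proof
    assume "q c = 0"
    then have q0: "coeff (q c) (m0 i0) = 0" by simp
    define c' where "c' m = (if m i0 = 0 then c (m(i0 := m0 i0)) else 0)" for m
    have inj: "inj_on (\<lambda>m. m(i0 := m0 i0)) {m. c' m \<noteq> 0}"
    proof (rule inj_onI)
      fix m m' assume *: "m \<in> {m. c' m \<noteq> 0}" "m' \<in> {m. c' m \<noteq> 0}" "m(i0 := m0 i0) = m'(i0 := m0 i0)"
      then have "m i0 = m' i0" by (auto simp: c'_def split: if_splits)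
      then show "m = m'" using *(3) by (metis fun_upd_triv fun_upd_upd)
    qed
    have img: "(\<lambda>m. m(i0 := m0 i0)) ` {m. c' m \<noteq> 0} = {m. c m \<noteq> 0 \<and> m i0 = m0 i0}"
    proof (intro equalityI subsetI)
      fix m assume m: "m \<in> {m. c m \<noteq> 0 \<and> m i0 = m0 i0}"
      then have "m(i0 := m0 i0) = m" by auto
      with m have "m = (m(i0 := 0))(i0 := m0 i0)" "c' (m(i0 := 0)) \<noteq> 0" by (auto simp: c'_def)
      then show "m \<in> (\<lambda>m. m(i0 := m0 i0)) ` {m. c' m \<noteq> 0}" by blast
    qed (auto simp: c'_def split: if_splits)
    have fin: "finite {m. c m \<noteq> 0}" using c by (simp add: Q_def)
    have "finite ((\<lambda>m. m(i0 := m0 i0)) ` {m. c' m \<noteq> 0})"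
      unfolding img by (rule finite_subset[OF _ fin]) auto
    then have fin': "finite {m. c' m \<noteq> 0}" using inj by (rule finite_imageD)
    have supp: "\<forall>m. c' m \<noteq> 0 \<longrightarrow> (\<forall>i. i \<notin> I \<longrightarrow> m i = 0)"
    proof (intro allI impI)
      fix m i assume "c' m \<noteq> 0" "i \<notin> I"
      then show "m i = 0"
        using c(1) by (cases "i = i0") (auto simp: c'_def Q_def split: if_splits dest!: spec[of _ "m(i0 := m0 i0)"])
    qed
    have "(\<Sum>m\<in>{m. c' m \<noteq> 0}. of_rat (c' m) * (\<Prod>i\<in>I. x i ^ m i)) =
        (\<Sum>m\<in>{m. c' m \<noteq> 0}. of_rat (c (m(i0 := m0 i0))) * (\<Prod>i\<in>I. x i ^ (m(i0 := m0 i0)) i))"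
    proof (rule sum.cong[OF refl])
      fix m assume "m \<in> {m. c' m \<noteq> 0}"
      then have "c' m = c (m(i0 := m0 i0))" by (auto simp: c'_def split: if_splits)
      moreover have "(\<Prod>i\<in>I. x i ^ m i) = (\<Prod>i\<in>I. x i ^ (m(i0 := m0 i0)) i)"
        using assms(2) by (intro prod.cong) auto
      ultimately show "of_rat (c' m) * (\<Prod>i\<in>I. x i ^ m i) =
        (of_rat (c (m(i0 := m0 i0))) * (\<Prod>i\<in>I. x i ^ (m(i0 := m0 i0)) i) :: real)" by simp
    qed
    also have "\<dots> = (\<Sum>m\<in>{m. c m \<noteq> 0 \<and> m i0 = m0 i0}. of_rat (c m) * (\<Prod>i\<in>I. x i ^ m i))"
      unfolding img[symmetric] sum.reindex[OF inj] by simp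
    also have "\<dots> = coeff (q c) (m0 i0)"
      unfolding q_def coeff_sum coeff_monom using fin
      by (simp add: sum.If_cases Int_def)
    also note q0
    finally have "c' (m0(i0 := 0)) = 0"
      by (rule alg_indep_QD[OF assms(3) fin' supp])
    then show False using c(2) by (simp add: c'_def)
  qed
  have "countable Q" unfolding Q_def using assms(1) by (intro countable_polynomials) simp
  then have "countable (\<Union>c\<in>Q \<inter> {c. \<exists>m. c m \<noteq> 0}. {t. poly (q c) t = 0})"
  proof (intro countable_UN countable_Int1)
    fix c assume "c \<in> Q \<inter> {c. \<exists>m. c m \<noteq> 0}"
    then have "q c \<noteq> 0" using qn by blast
    then show "countable {t. poly (q c) t = 0}"
      by (intro countable_finite poly_roots_finite)
  qed
  then have "(\<Union>c\<in>Q \<inter> {c. \<exists>m. c m \<noteq> 0}. {t. poly (q c) t = 0}) \<noteq> UNIV"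
    using uncountable_UNIV_real by (auto simp del: UN_iff)
  then obtain t where t: "\<And>c m. c \<in> Q \<Longrightarrow> c m \<noteq> 0 \<Longrightarrow> poly (q c) t \<noteq> 0"
    by blast
  have "alg_indep_Q ?J (x(i0 := t))"
    unfolding alg_indep_Q_def qt[symmetric]
  proof (intro allI impI)
    fix c :: "('a \<Rightarrow> nat) \<Rightarrow> rat" and m
    assume "finite {m. c m \<noteq> 0}" "\<forall>m. c m \<noteq> 0 \<longrightarrow> (\<forall>i. i \<notin> ?J \<longrightarrow> m i = 0)"
      and 0: "poly (q c) t = 0"
    then have "c \<in> Q" by (simp add: Q_def)
    from t[OF this] 0 show "c m = 0" by blast
  qed
  then show ?thesis ..
qed

lemma alg_indep_Q_exists: "finite I \<Longrightarrow> \<exists>x. alg_indep_Q I x"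
proof (induction I rule: finite_induct)
  case empty
  have "alg_indep_Q {} x" for x :: "'a \<Rightarrow> real"
  proof (unfold alg_indep_Q_def, intro allI impI)
    fix c :: "('a \<Rightarrow> nat) \<Rightarrow> rat" and m
    assume *: "\<forall>m. c m \<noteq> 0 \<longrightarrow> (\<forall>i. i \<notin> {} \<longrightarrow> m i = 0)"
      "(\<Sum>m | c m \<noteq> 0. of_rat (c m) * (\<Prod>i\<in>{}. x i ^ m i)) = 0"
    have z: "m = (\<lambda>_. 0)" if "c m \<noteq> 0" for m using that *(1) by auto
    show "c m = 0"
    proof (rule ccontr)
      assume "c m \<noteq> 0"
      then have "{m. c m \<noteq> 0} = {\<lambda>_. 0}" using z by blast
      then show False using *(2) by auto
    qed
  qed
  then show ?case by blast
next
  case (insert i I)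
  then obtain x where "alg_indep_Q I x" by blast
  from alg_indep_Q_extend[OF insert.hyps this] show ?case by blast
qed

lemma generic_config_exists: "\<exists>p. generic_config d n p"
proof -
  have "finite (coord_index d n)" by (simp add: coord_index_def)
  then obtain x where "alg_indep_Q (coord_index d n) x" using alg_indep_Q_exists[of "coord_index d n"] by blast
  then have "generic_config d n (\<lambda>v j. x (v, j))" by (simp add: generic_config_def)
  then show ?thesis by (intro exI[of _ "\<lambda>v j. x (v, j)"])
qed

section \<open>Circuits from a partition into series classes\<close>

text \<open>The parts are disjoint, so deleting one element makes at most one part incomplete, and
  the number of deletions needed equals the number of parts still to be broken. The truncated
  difference is 0 when \<open>X\<close> already has \<open>m\<close> incomplete parts in
  \<open>J\<close>.\<close>

lemma Max_card_partition:
  fixes Q :: "'q \<Rightarrow> 'e set"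
  assumes fin: "finite X" "finite J" "finite K" and JK: "J \<inter> K = {}"
    and disj: "\<And>q q'. q \<in> J \<union> K \<Longrightarrow> q' \<in> J \<union> K \<Longrightarrow> q \<noteq> q' \<Longrightarrow> Q q \<inter> Q q' = {}"
    and ne: "\<And>q. q \<in> J \<union> K \<Longrightarrow> Q q \<noteq> {}"
    and J: "m \<le> card J"
    and ind: "\<And>Y. Y \<subseteq> X \<Longrightarrow> indep Y \<longleftrightarrow> m \<le> card {q\<in>J. \<not> Q q \<subseteq> Y} \<and> (\<forall>q\<in>K. \<not> Q q \<subseteq> Y)"
  shows "Max (card ` {Y. Y \<subseteq> X \<and> finite Y \<and> indep Y}) +
    ((m - card {q\<in>J. \<not> Q q \<subseteq> X}) + card {q\<in>K. Q q \<subseteq> X}) = card X"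
proof -
  define z where "z = card {q\<in>J. \<not> Q q \<subseteq> X}"
  define \<nu> where "\<nu> = (m - z) + card {q\<in>K. Q q \<subseteq> X}"
  have split: "card (U \<union> V) = card U + card V" if "U \<subseteq> J" "V \<subseteq> K" for U V
    using that fin JK by (intro card_Un_disjoint) (auto intro: finite_subset)
  have le: "card Y + \<nu> \<le> card X" if Y: "Y \<subseteq> X" "indep Y" for Y
  proof -
    \<comment> \<open>The parts complete in \<open>X\<close> that \<open>Y\<close> breaks. Each
      costs an element of \<open>X - Y\<close>, and disjointness makes these elements
      distinct.\<close>
    define W where "W = {q\<in>J. Q q \<subseteq> X \<and> \<not> Q q \<subseteq> Y} \<union> {q\<in>K. Q q \<subseteq> X}"
    have Wsub: "W \<subseteq> J \<union> K" by (auto simp: W_def)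
    have "m \<le> card {q\<in>J. \<not> Q q \<subseteq> Y}" using ind Y by blast
    also have "\<dots> \<le> card ({q\<in>J. \<not> Q q \<subseteq> X} \<union> {q\<in>J. Q q \<subseteq> X \<and> \<not> Q q \<subseteq> Y})"
      using fin by (intro card_mono) auto
    also have "\<dots> \<le> z + card {q\<in>J. Q q \<subseteq> X \<and> \<not> Q q \<subseteq> Y}"
      unfolding z_def by (rule card_Un_le)
    finally have "\<nu> \<le> card W" unfolding \<nu>_def W_def by (subst split) auto
    have "\<exists>e. e \<in> Q q \<inter> (X - Y)" if "q \<in> W" for q
      using that ind[OF Y(1)] Y(2) unfolding W_def by blast
    then obtain f where f: "\<And>q. q \<in> W \<Longrightarrow> f q \<in> Q q \<inter> (X - Y)" by metis
    have "inj_on f W"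
    proof (rule inj_onI)
      fix q q' assume q: "q \<in> W" "q' \<in> W" "f q = f q'"
      then have "f q \<in> Q q \<inter> Q q'" using f[of q] f[of q'] by auto
      then show "q = q'" using disj[of q q'] q Wsub by blast
    qed
    moreover have "f ` W \<subseteq> X - Y" using f by blast
    ultimately have "card W \<le> card (X - Y)"
      using fin by (intro card_inj_on_le) auto
    also have "\<dots> = card X - card Y" using Y fin by (simp add: card_Diff_subset finite_subset)
    finally show ?thesis using \<open>\<nu> \<le> card W\<close> card_mono[OF fin(1) Y(1)] by linarith
  qed
  have "card {q\<in>J. \<not> Q q \<subseteq> X} + card {q\<in>J. Q q \<subseteq> X} = card J"
    using fin by (subst card_Un_disjoint[symmetric]) (auto intro: arg_cong[where f = card])
  then have "m - z \<le> card {q\<in>J. Q q \<subseteq> X}" using J by (simp add: z_def)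
  then obtain U where U: "U \<subseteq> {q\<in>J. Q q \<subseteq> X}" "card U = m - z"
    by (meson obtain_subset_with_card_n)
  \<comment> \<open>One deletion in each part of \<open>W\<close> suffices: \<open>U\<close>
    supplies the incomplete parts that \<open>J\<close> still lacks, and the others are the complete
    parts of \<open>K\<close>.\<close>
  define W where "W = U \<union> {q\<in>K. Q q \<subseteq> X}"
  have W: "W \<subseteq> J \<union> K" "\<And>q. q \<in> W \<Longrightarrow> Q q \<subseteq> X" using U by (auto simp: W_def)
  have cardW: "card W = \<nu>"
    unfolding W_def \<nu>_def using U by (subst split) auto
  have "\<exists>e. e \<in> Q q" if "q \<in> W" for q using that W ne by blast
  then obtain f where f: "\<And>q. q \<in> W \<Longrightarrow> f q \<in> Q q" by metis
  have "inj_on f W"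
  proof (rule inj_onI)
    fix q q' assume q: "q \<in> W" "q' \<in> W" "f q = f q'"
    then have "f q \<in> Q q \<inter> Q q'" using f[of q] f[of q'] by auto
    then show "q = q'" using disj[of q q'] q W by blast
  qed
  then have cardf: "card (f ` W) = \<nu>" using cardW by (simp add: card_image)
  have fX: "f ` W \<subseteq> X" using f W by blast
  define Y where "Y = X - f ` W"
  have "card Y + \<nu> = card X"
    using fX fin cardf card_mono[OF fin(1) fX]
    by (simp add: Y_def card_Diff_subset finite_subset)
  moreover have YX: "Y \<subseteq> X" by (auto simp: Y_def)
  moreover have "indep Y"
  proof -
    have miss: "\<not> Q q \<subseteq> Y" if "q \<in> W" for q using f[OF that] that by (auto simp: Y_def)
    have "m \<le> card ({q\<in>J. \<not> Q q \<subseteq> X} \<union> U)"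
      using U fin unfolding z_def
      by (subst card_Un_disjoint) (auto intro: finite_subset)
    also have "\<dots> \<le> card {q\<in>J. \<not> Q q \<subseteq> Y}"
      using fin YX miss U by (intro card_mono) (auto simp: W_def)
    finally have "m \<le> card {q\<in>J. \<not> Q q \<subseteq> Y}" .
    moreover have "\<forall>q\<in>K. \<not> Q q \<subseteq> Y" using miss YX by (auto simp: W_def)
    ultimately show ?thesis using ind[OF YX] by blast
  qed
  ultimately have Y: "Y \<subseteq> X" "indep Y" "card Y + \<nu> = card X" by auto
  have "Max (card ` {Y. Y \<subseteq> X \<and> finite Y \<and> indep Y}) = card Y"
  proof (rule Max_eqI)
    show "finite (card ` {Y. Y \<subseteq> X \<and> finite Y \<and> indep Y})" using fin by simp
    show "card Y \<in> card ` {Y. Y \<subseteq> X \<and> finite Y \<and> indep Y}"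
      using Y fin by (auto intro: finite_subset)
    fix y assume "y \<in> card ` {Y. Y \<subseteq> X \<and> finite Y \<and> indep Y}"
    then obtain Z where "y = card Z" "Z \<subseteq> X" "indep Z" by blast
    then show "y \<le> card Y" using le[of Z] Y(3) by linarith
  qed
  then show ?thesis using Y(3) by (simp add: \<nu>_def z_def)
qed

text \<open>The nullity is that of the direct sum of a rank-two uniform matroid on the parts indexed
  by \<open>J\<close> and the free matroid on the parts indexed by \<open>K\<close>, dualized.\<close>

lemma kfold_circuit_partition:
  fixes Q :: "'q \<Rightarrow> 'e set" and r :: "'e set \<Rightarrow> nat"
  assumes fin: "finite D" "finite J" "finite K" and JK: "J \<inter> K = {}"
    and disj: "\<And>q q'. q \<in> J \<union> K \<Longrightarrow> q' \<in> J \<union> K \<Longrightarrow> q \<noteq> q' \<Longrightarrow> Q q \<inter> Q q' = {}"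
    and ne: "\<And>q. q \<in> J \<union> K \<Longrightarrow> Q q \<noteq> {}"
    and D: "D = (\<Union>q\<in>J \<union> K. Q q)" "D \<subseteq> E"
    and nullity: "\<And>X. X \<subseteq> D \<Longrightarrow>
      r X + ((2 - card {q\<in>J. \<not> Q q \<subseteq> X}) + card {q\<in>K. Q q \<subseteq> X}) = card X"
  shows "kfold_circuit r E (card K + 2) D"
    and "principal_partition r E (card K + 2) D (Q ` (J \<union> K))"
    and "card (Q ` (J \<union> K)) = card J + card K"
proof -
  define \<nu> where "\<nu> X = (2 - card {q\<in>J. \<not> Q q \<subseteq> X}) + card {q\<in>K. Q q \<subseteq> X}" for X
  have r: "r X + \<nu> X = card X" if "X \<subseteq> D" for X
    using nullity[OF that] by (simp add: \<nu>_def)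
  have QD: "Q q \<subseteq> D" if "q \<in> J \<union> K" for q using that D by blast
  \<comment> \<open>Disjointness confines the effect of a deletion to its own part, whether one
    element or the whole part goes.\<close>
  have sub: "Q q' \<subseteq> X - A \<longleftrightarrow> Q q' \<subseteq> X \<and> q' \<noteq> q"
    if "q \<in> J \<union> K" "q' \<in> J \<union> K" "A \<subseteq> Q q" "A \<noteq> {}" for q q' A X
    using disj[of q q'] that by blast
  have \<nu>D: "\<nu> D = card K + 2"
  proof -
    have *: "{q\<in>J. \<not> Q q \<subseteq> D} = {}" "{q\<in>K. Q q \<subseteq> D} = K" using QD by auto
    show ?thesis unfolding \<nu>_def * by simp
  qed
  have \<nu>1: "\<nu> (D - A) = card K + 1" if q: "q \<in> J \<union> K" "A \<subseteq> Q q" "A \<noteq> {}" for q A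
  proof -
    have s: "Q q' \<subseteq> D - A \<longleftrightarrow> q' \<noteq> q" if "q' \<in> J \<union> K" for q'
      using sub[OF q(1) that q(2,3), of D] QD[OF that] by simp
    have e: "{q'\<in>J. \<not> Q q' \<subseteq> D - A} = J \<inter> {q}"
      "{q'\<in>K. Q q' \<subseteq> D - A} = K - {q}" using s by auto
    have "card K = card (K - {q}) + card (K \<inter> {q})"
      using fin by (subst card_Un_disjoint[symmetric]) (auto intro: arg_cong[where f = card])
    moreover have "card (J \<inter> {q}) + card (K \<inter> {q}) = 1"
      using q(1) JK by (cases "q \<in> J") auto
    ultimately show ?thesis unfolding \<nu>_def e by linarith
  qed
  \<comment> \<open>A second deletion, from a different part, lowers the nullity once more; this
    makes \<open>D - Q q\<close> cyclic.\<close>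
  have \<nu>2: "\<nu> (D - Q q - {e}) = card K"
    if q: "q \<in> J \<union> K" "q' \<in> J \<union> K" "q \<noteq> q'" "e \<in> Q q'" for q q' e
  proof -
    have s: "Q q'' \<subseteq> D - Q q - {e} \<longleftrightarrow> q'' \<noteq> q \<and> q'' \<noteq> q'" if "q'' \<in> J \<union> K" for q''
      using sub[OF q(2) that, of "{e}" "D - Q q"] sub[OF q(1) that, of "Q q" D] ne[OF q(1)]
        QD[OF that] q(4) by auto
    have e: "{q''\<in>J. \<not> Q q'' \<subseteq> D - Q q - {e}} = J \<inter> {q, q'}"
      "{q''\<in>K. Q q'' \<subseteq> D - Q q - {e}} = K - {q, q'}" using s by auto
    have "card K = card (K - {q, q'}) + card (K \<inter> {q, q'})"
      using fin by (subst card_Un_disjoint[symmetric]) (auto intro: arg_cong[where f = card])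
    moreover have "card (J \<inter> {q, q'}) + card (K \<inter> {q, q'}) = 2"
    proof -
      have "card (J \<inter> {q, q'} \<union> K \<inter> {q, q'}) = card (J \<inter> {q, q'}) + card (K \<inter> {q, q'})"
        using fin JK by (intro card_Un_disjoint) auto
      moreover have "J \<inter> {q, q'} \<union> K \<inter> {q, q'} = {q, q'}" using q by auto
      ultimately show ?thesis using q(3) by simp
    qed
    ultimately show ?thesis unfolding \<nu>_def e by linarith
  qed
  show kD: "kfold_circuit r E (card K + 2) D"
    unfolding kfold_circuit_def cyclic_set_def
  proof (intro conjI ballI)
    fix e assume e: "e \<in> D"
    then obtain q where "q \<in> J \<union> K" "e \<in> Q q" using D by blast
    then have "\<nu> (D - {e}) = card K + 1" by (intro \<nu>1) auto
    then show "r (D - {e}) = r D"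
      using r[of "D - {e}"] r[of D] \<nu>D card_Suc_Diff1[OF fin(1) e] by fastforce
  qed (use D fin r[of D] \<nu>D in auto)
  have part: "kfold_circuit r E (card K + 1) (D - Q q)" if q: "q \<in> J \<union> K" for q
    unfolding kfold_circuit_def cyclic_set_def
  proof (intro conjI ballI)
    have n1: "\<nu> (D - Q q) = card K + 1" using q ne by (intro \<nu>1) auto
    show "int (r (D - Q q)) = int (card (D - Q q)) - int (card K + 1)"
      using r[of "D - Q q"] n1 by auto
    fix e assume e: "e \<in> D - Q q"
    then obtain q' where "q' \<in> J \<union> K" "e \<in> Q q'" using D by blast
    then have "\<nu> (D - Q q - {e}) = card K" using e q by (intro \<nu>2[where q' = q']) auto
    moreover have "Suc (card (D - Q q - {e})) = card (D - Q q)"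
      using e fin by (intro card_Suc_Diff1) auto
    ultimately show "r (D - Q q - {e}) = r (D - Q q)"
      using r[of "D - Q q - {e}"] r[of "D - Q q"] n1 by fastforce
  qed (use D fin in auto)
  have conv: "\<exists>q\<in>J \<union> K. C = D - Q q" if C: "C \<subseteq> D" "kfold_circuit r E (card K + 1) C" for C
  proof -
    define z where "z = {q\<in>J. \<not> Q q \<subseteq> C}"
    define w where "w = {q\<in>K. \<not> Q q \<subseteq> C}"
    have "int (r C) = int (card C) - int (card K + 1)" using C(2) by (simp add: kfold_circuit_def)
    then have \<nu>C: "\<nu> C = card K + 1" using r[OF C(1)] by linarith
    have "card w + card {q\<in>K. Q q \<subseteq> C} = card K"
      using fin unfolding w_def
      by (subst card_Un_disjoint[symmetric]) (auto intro: arg_cong[where f = card])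
    then have "card z + card w = 1" using \<nu>C unfolding \<nu>_def z_def[symmetric] by linarith
    moreover have "card (z \<union> w) = card z + card w"
      using fin JK by (intro card_Un_disjoint) (auto simp: z_def w_def)
    ultimately obtain q where q: "z \<union> w = {q}" by (metis card_1_singletonE)
    then have qJK: "q \<in> J \<union> K" "\<not> Q q \<subseteq> C" by (auto simp: z_def w_def)
    have others: "Q q' \<subseteq> C" if "q' \<in> J \<union> K" "q' \<noteq> q" for q'
      using that q by (auto simp: z_def w_def)
    \<comment> \<open>The nullity leaves exactly one incomplete part. An element of \<open>C\<close>
      in it would be a coloop: deleting it keeps the nullity and lowers the rank, against
      cyclicity.\<close>
    have "e \<notin> Q q" if e: "e \<in> C" for e
    proof
      assume eq: "e \<in> Q q"
      have "Q q' \<subseteq> C - {e} \<longleftrightarrow> Q q' \<subseteq> C" if "q' \<in> J \<union> K" for q'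
        using sub[OF qJK(1) that, of "{e}" C] eq qJK(2) by auto
      then have "\<nu> (C - {e}) = \<nu> C"
        unfolding \<nu>_def by (intro arg_cong2[where f = "(+)"] arg_cong2[where f = "(-)"] arg_cong[where f = card]) auto
      moreover have "r (C - {e}) = r C"
        using C(2) e by (simp add: kfold_circuit_def cyclic_set_def)
      moreover have "Suc (card (C - {e})) = card C"
        using e C(1) fin by (intro card_Suc_Diff1) (auto intro: finite_subset)
      moreover have "r (C - {e}) + \<nu> (C - {e}) = card (C - {e})" using C(1) by (intro r) auto
      ultimately show False using r[OF C(1)] by linarith
    qed
    moreover have "D - Q q \<subseteq> C" using others D(1) by blast
    ultimately have "C = D - Q q" using C(1) by blast
    then show ?thesis using qJK by blast
  qed
  show "principal_partition r E (card K + 2) D (Q ` (J \<union> K))"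
    unfolding principal_partition_def
  proof (intro conjI)
    show "\<forall>A\<in>Q ` (J \<union> K). A \<noteq> {} \<and> A \<subseteq> D" using ne QD by auto
    show "\<forall>A\<in>Q ` (J \<union> K). \<forall>B\<in>Q ` (J \<union> K). A \<noteq> B \<longrightarrow> A \<inter> B = {}" using disj by blast
    show "(\<lambda>A. D - A) ` Q ` (J \<union> K) = {C. C \<subseteq> D \<and> kfold_circuit r E (card K + 2 - 1) C}"
    proof (intro equalityI subsetI)
      fix C assume "C \<in> (\<lambda>A. D - A) ` Q ` (J \<union> K)"
      then obtain q where q: "q \<in> J \<union> K" "C = D - Q q" by blast
      then show "C \<in> {C. C \<subseteq> D \<and> kfold_circuit r E (card K + 2 - 1) C}"
        using part[OF q(1)] by simp
    next
      fix C assume "C \<in> {C. C \<subseteq> D \<and> kfold_circuit r E (card K + 2 - 1) C}"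
      then have "C \<subseteq> D" "kfold_circuit r E (card K + 1) C" by simp_all
      from conv[OF this] show "C \<in> (\<lambda>A. D - A) ` Q ` (J \<union> K)" by blast
    qed
    show "\<Union>(Q ` (J \<union> K)) = D" using D by simp
  qed
  have "inj_on Q (J \<union> K)"
    by (rule inj_onI) (metis disj ne Int_absorb)
  then show "card (Q ` (J \<union> K)) = card J + card K"
    using fin JK by (simp add: card_image card_Un_disjoint)
qed

section \<open>Independence of generic points and their products\<close>

text \<open>Barycentric coordinates with respect to the standard simplex, so that affine conditions
  become linear.\<close>

definition hat :: "nat \<Rightarrow> (nat \<Rightarrow> nat \<Rightarrow> real) \<Rightarrow> nat \<Rightarrow> nat \<Rightarrow> real" where
  "hat d p v i = (if i < d then p v i else if i = d then 1 - (\<Sum>j<d. p v j) else 0)"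

text \<open>An entry of the symmetrised tensor product of two points. On a pair
  \<open>(v, v)\<close> it is twice the square of the point, the source of the factors 2 in later
  coefficients.\<close>

definition sym_prod :: "nat \<Rightarrow> (nat \<Rightarrow> nat \<Rightarrow> real) \<Rightarrow> nat \<times> nat \<Rightarrow> nat \<times> nat \<Rightarrow> real" where
  "sym_prod d p e ij =
    hat d p (fst e) (fst ij) * hat d p (snd e) (snd ij) +
    hat d p (fst e) (snd ij) * hat d p (snd e) (fst ij)"

lemma sum_hat: "(\<Sum>i\<le>d. hat d p v i) = 1"
  by (simp add: hat_def lessThan_Suc_atMost[symmetric])

text \<open>Lets special positions be prescribed directly by d+1 barycentric coordinates, although a
  configuration only supplies the first d of them.\<close>

lemma hat_barycentric:
  assumes "(\<Sum>j\<le>d. h v j) = 1"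
  shows "hat d h v i = (if i \<le> d then h v i else 0)"
  using assms by (auto simp: hat_def lessThan_Suc_atMost[symmetric])

lemma polyfun_hat:
  assumes "v < n"
  shows "(\<lambda>x. hat d (\<lambda>v j. x (v, j)) v i) \<in> polyfun (coord_index d n)"
proof -
  have x: "(\<lambda>x. x (v, j)) \<in> polyfun (coord_index d n)" if "j < d" for j
    using that assms by (intro polyfun.var) (simp add: coord_index_def)
  consider "i < d" | "i = d" | "i > d" by linarith
  then show ?thesis
  proof cases
    case 2
    have "(\<lambda>x. 1 - (\<Sum>j<d. x (v, j))) \<in> polyfun (coord_index d n)"
      by (intro polyfun_diff polyfun_1 polyfun_sum x) simp
    with 2 show ?thesis by (simp add: hat_def)
  qed (simp_all add: hat_def x polyfun_0)
qed

lemma polyfun_sym_prod: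
  assumes "fst e < n" "snd e < n"
  shows "(\<lambda>x. sym_prod d (\<lambda>v j. x (v, j)) e ij) \<in> polyfun (coord_index d n)"
  unfolding sym_prod_def using assms by (intro polyfun.add polyfun.mult polyfun_hat)

text \<open>Placed at distinct vertices of the simplex, the points have unit vectors as barycentric
  coordinates; the independence then passes to the generic position.\<close>

lemma generic_hat_independent:
  assumes "generic_config d n p" "S \<subseteq> {..<n}" "card S \<le> d + 1"
  shows "lin_indep_family S (hat d p)"
proof -
  have fS: "finite S" using assms(2) finite_subset by blast
  have "card S \<le> card {..d}" using assms(3) by simp
  then obtain f where f: "f ` S \<subseteq> {..d}" "inj_on f S"
    using card_le_inj[OF fS] by blast
  define h where "h v i = (if i = f v then 1 else 0 :: real)" for v i :: nat
  have hh: "hat d h v i = h v i" if "v \<in> S" for v i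
  proof -
    have "f v \<le> d" using that f by auto
    then show ?thesis by (subst hat_barycentric) (auto simp: h_def)
  qed
  have "lin_indep_family S (hat d h)"
  proof (rule lin_indep_familyI)
    fix c v assume 0: "\<And>i. (\<Sum>e\<in>S. c e * hat d h e i) = 0" and v: "v \<in> S"
    have "(\<Sum>e\<in>S. c e * hat d h e (f v)) = (\<Sum>e\<in>S. if e = v then c e else 0)"
      using f(2) v by (intro sum.cong) (auto simp: hh h_def inj_on_eq_iff)
    also have "\<dots> = c v" using fS v by simp
    finally show "c v = 0" using 0 by simp
  qed
  \<comment> \<open>The configuration is rewritten as a function of the pair \<open>(w, j)\<close>,
    the argument on which polynomial functions are evaluated.\<close>
  then have "lin_indep_family S
      (\<lambda>v i. hat d (\<lambda>w j. (case (w, j) of (w, j) \<Rightarrow> h w j)) v i)" by simp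
  moreover have "alg_indep_Q (coord_index d n) (\<lambda>(v, j). p v j)"
    using assms(1) by (simp add: generic_config_def)
  moreover have "(\<lambda>x. hat d (\<lambda>v j. x (v, j)) v i) \<in> polyfun (coord_index d n)" if "v \<in> S" for v i
    using that assms(2) by (intro polyfun_hat) auto
  ultimately have "lin_indep_family S
      (\<lambda>v i. hat d (\<lambda>w j. (case (w, j) of (w, j) \<Rightarrow> p w j)) v i)"
    using lin_indep_family_generic[where V = "\<lambda>v i x. hat d (\<lambda>w j. x (w, j)) v i"
        and I = "coord_index d n" and x = "\<lambda>(v, j). p v j" and y = "\<lambda>(v, j). h v j" and F = S] fS
    by (simp add: coord_index_def)
  then show ?thesis by simp
qed

lemma sum_Id_on_insert:
  assumes "finite V" "a \<noteq> b"
  shows "(\<Sum>e\<in>Id_on V \<union> {(a, b)}. f e) = (\<Sum>v\<in>V. f (v, v)) + f (a, b)"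
proof -
  have "Id_on V = (\<lambda>v. (v, v)) ` V" by auto
  moreover have "inj_on (\<lambda>v. (v, v)) V" by (auto intro: inj_onI)
  ultimately have "(\<Sum>e\<in>Id_on V. f e) = (\<Sum>v\<in>V. f (v, v))" by (simp add: sum.reindex)
  moreover have "finite (Id_on V)" using \<open>Id_on V = _\<close> assms(1) by simp
  moreover have "(a, b) \<notin> Id_on V" using assms(2) by auto
  ultimately show ?thesis by (simp add: add.commute)
qed

text \<open>Specialising the points to vertices and edge midpoints of a simplex, the product of the two
  vertices \<open>0\<close> and \<open>1\<close> and the squares of midpoints of distinct edges other than \<open>01\<close> have
  disjoint off-diagonal supports.\<close>

lemma sym_prod_special:
  assumes fV: "finite V" and ab: "a \<in> V" "b \<in> V" "a \<noteq> b" and d: "1 \<le> d"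
    and g: "inj_on g V" "\<And>v. v \<in> V \<Longrightarrow> fst (g v) \<le> snd (g v) \<and> snd (g v) \<le> d \<and> g v \<noteq> (0, 1)"
      "g a = (0, 0)" "g b = (1, 1)"
  defines "h \<equiv> \<lambda>v i. ((if i = fst (g v) then 1 else 0) + (if i = snd (g v) then 1 else 0)) / (2 :: real)"
  shows "lin_indep_family (Id_on V \<union> {(a, b)}) (sym_prod d h)"
proof (rule lin_indep_familyI)
  fix c e
  assume 0: "\<And>ij. (\<Sum>e\<in>Id_on V \<union> {(a, b)}. c e * sym_prod d h e ij) = 0"
    and e: "e \<in> Id_on V \<union> {(a, b)}"
  \<comment> \<open>A label \<open>(i, i)\<close> makes both indicators coincide and yields vertex
    \<open>i\<close>; any other label yields the midpoint of an edge.\<close>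
  have hh: "hat d h v i = h v i" if v: "v \<in> V" for v i
  proof -
    have "(\<Sum>j\<le>d. h v j) = 1"
      using g(2)[OF v] by (simp add: h_def sum_divide_distrib[symmetric] sum.distrib)
    then show ?thesis using g(2)[OF v] by (subst hat_barycentric) (auto simp: h_def)
  qed
  have S: "(\<Sum>v\<in>V. 2 * c (v, v) * (h v i * h v j)) +
      c (a, b) * (h a i * h b j + h a j * h b i) = 0" for i j
  proof -
    have "(\<Sum>v\<in>V. c (v, v) * sym_prod d h (v, v) (i, j)) = (\<Sum>v\<in>V. 2 * c (v, v) * (h v i * h v j))"
      by (intro sum.cong) (auto simp: sym_prod_def hh)
    then show ?thesis
      using 0[of "(i, j)"] ab unfolding sum_Id_on_insert[OF fV ab(3)] by (simp add: sym_prod_def hh)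
  qed
  have off: "h v i * h v j = (if g v = (i, j) then 1 / 4 else 0)" if "v \<in> V" "i < j" for v i j
    using g(2)[OF that(1)] that(2) by (cases "g v") (auto simp: h_def)
  \<comment> \<open>No label is \<open>(0, 1)\<close>, so entry (0, 1) sees only the product of
    \<open>a\<close> and \<open>b\<close>.\<close>
  have cab: "c (a, b) = 0"
  proof -
    have "(\<Sum>v\<in>V. 2 * c (v, v) * (h v 0 * h v 1)) = 0"
      using off g(2) by (intro sum.neutral) auto
    then show ?thesis using S[of 0 1] g(3,4) by (simp add: h_def)
  qed
  have cv: "c (v, v) = 0" if v: "v \<in> V" "fst (g v) < snd (g v)" for v
  proof -
    obtain i j where ij: "g v = (i, j)" by fastforce
    have "(\<Sum>w\<in>V. 2 * c (w, w) * (h w i * h w j)) = (\<Sum>w\<in>V. if w = v then c (v, v) / 2 else 0)"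
    proof (intro sum.cong refl)
      fix w assume w: "w \<in> V"
      then have "g w = (i, j) \<longleftrightarrow> w = v" using ij g(1) v(1) by (metis inj_onD)
      then show "2 * c (w, w) * (h w i * h w j) = (if w = v then c (v, v) / 2 else 0)"
        using off[OF w, of i j] v(2) ij by auto
    qed
    also have "\<dots> = c (v, v) / 2" using fV v by simp
    finally show ?thesis using S[of i j] cab by simp
  qed
  \<comment> \<open>Once the midpoints have coefficient 0, the diagonal entry \<open>(i, i)\<close>
    sees only the point placed at vertex \<open>i\<close>.\<close>
  have cv': "c (v, v) = 0" if v: "v \<in> V" for v
  proof (cases "fst (g v) < snd (g v)")
    case False
    then obtain i where i: "g v = (i, i)" using g(2)[OF v] by (cases "g v") auto
    have "2 * c (w, w) * (h w i * h w i) = (if w = v then 2 * c (v, v) else 0)" if w: "w \<in> V" for w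
    proof (cases "fst (g w) < snd (g w)")
      case True
      then show ?thesis using cv[OF w] i by auto
    next
      case False
      then obtain k where k: "g w = (k, k)" using g(2)[OF w] by (cases "g w") auto
      have "k = i \<longleftrightarrow> w = v" using k i g(1) v w by (metis inj_onD prod.inject)
      then show ?thesis using k by (auto simp: h_def)
    qed
    then have "(\<Sum>w\<in>V. 2 * c (w, w) * (h w i * h w i)) = (\<Sum>w\<in>V. if w = v then 2 * c (v, v) else 0)"
      by (intro sum.cong) auto
    also have "\<dots> = 2 * c (v, v)" using fV v by simp
    finally show ?thesis using S[of i i] cab by simp
  qed (use cv v in blast)
  show "c e = 0" using e cab cv' by auto
qed

lemma simplex_edges_labelling:
  assumes "finite V" "a \<in> V" "b \<in> V" "a \<noteq> b" "4 \<le> d" "card V \<le> 2 * d + 5"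
  obtains g :: "'a \<Rightarrow> nat \<times> nat" where "inj_on g V"
    "\<And>v. v \<in> V \<Longrightarrow> fst (g v) \<le> snd (g v) \<and> snd (g v) \<le> d \<and> g v \<noteq> (0, 1)"
    "g a = (0, 0)" "g b = (1, 1)"
proof -
  \<comment> \<open>The set has 3d labels for the at most 2d+3 points other than \<open>a\<close>
    and \<open>b\<close>. At d = 4 it consists of all pairs i \<le> j \<le> d except (0, 0), (0, 1)
    and (1, 1); the labels (3, 4) and (4, 4) require \<open>4 \<le> d\<close>.\<close>
  define T :: "(nat \<times> nat) set" where "T = {0..2} \<times> {2..d} \<union> {(3, 3), (3, 4), (4, 4)}"
  have "card T = card ({0..2::nat} \<times> {2..d}) + card {(3::nat, 3::nat), (3, 4), (4, 4)}"
    unfolding T_def by (intro card_Un_disjoint) auto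
  then have T: "card T = 3 * d" "finite T" using assms(5) by (auto simp: T_def)
  have "card (V - {a, b}) = card V - 2" using assms by (simp add: card_Diff_subset)
  then have "card (V - {a, b}) \<le> card T" using T assms(5,6) by simp
  then obtain f where f: "f ` (V - {a, b}) \<subseteq> T" "inj_on f (V - {a, b})"
    using card_le_inj[of "V - {a, b}" T] assms(1) T(2) by blast
  define g where "g = f(a := (0, 0), b := (1, 1))"
  have gf: "g v = f v" "f v \<in> T" if "v \<in> V" "v \<noteq> a" "v \<noteq> b" for v
    using that f(1) by (auto simp: g_def)
  have gab: "g a = (0, 0)" "g b = (1, 1)" using assms(4) by (auto simp: g_def)
  have T': "t \<in> T \<Longrightarrow> fst t \<le> snd t \<and> snd t \<le> d \<and> t \<noteq> (0, 0) \<and> t \<noteq> (0, 1) \<and> t \<noteq> (1, 1)" for t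
    using assms(5) by (auto simp: T_def)
  show ?thesis
  proof
    show "inj_on g V"
    proof (rule inj_onI)
      fix x y assume xy: "x \<in> V" "y \<in> V" "g x = g y"
      show "x = y"
      proof (cases "x \<in> {a, b} \<or> y \<in> {a, b}")
        case True
        then show ?thesis using xy gab gf T' by (metis insert_iff empty_iff prod.inject zero_neq_one)
      next
        case False
        then show ?thesis using xy gf[of x] gf[of y] inj_onD[OF f(2), of x y] by auto
      qed
    qed
    show "fst (g v) \<le> snd (g v) \<and> snd (g v) \<le> d \<and> g v \<noteq> (0, 1)" if "v \<in> V" for v
      using that gab gf[of v] T'[of "f v"] assms(5) by (cases "v = a \<or> v = b") auto
  qed (fact gab)+
qed

lemma generic_sym_prod_independent:
  assumes "generic_config d n p" "V \<subseteq> {..<n}" "card V \<le> 2 * d + 5" "4 \<le> d"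
    and "a \<in> V" "b \<in> V" "a \<noteq> b"
  shows "lin_indep_family (Id_on V \<union> {(a, b)}) (sym_prod d p)"
proof -
  have fV: "finite V" using assms(2) finite_subset by blast
  obtain g :: "nat \<Rightarrow> nat \<times> nat" where g: "inj_on g V"
    "\<And>v. v \<in> V \<Longrightarrow> fst (g v) \<le> snd (g v) \<and> snd (g v) \<le> d \<and> g v \<noteq> (0, 1)"
    "g a = (0, 0)" "g b = (1, 1)"
    using simplex_edges_labelling[OF fV assms(5-7,4,3)] by blast
  define h where "h v i = ((if i = fst (g v) then 1 else 0) + (if i = snd (g v) then 1 else 0)) / (2 :: real)"
    for v i :: nat
  have "1 \<le> d" using assms(4) by simp
  from sym_prod_special[OF fV assms(5-7) this g, folded h_def]
  have "lin_indep_family (Id_on V \<union> {(a, b)})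
      (\<lambda>e ij. sym_prod d (\<lambda>w j. (case (w, j) of (w, j) \<Rightarrow> h w j)) e ij)"
    by (simp add: h_def[abs_def])
  moreover have "alg_indep_Q (coord_index d n) (\<lambda>(v, j). p v j)"
    using assms(1) by (simp add: generic_config_def)
  moreover have "(\<lambda>x. sym_prod d (\<lambda>v j. x (v, j)) e ij) \<in> polyfun (coord_index d n)"
    if "e \<in> Id_on V \<union> {(a, b)}" for e ij
    using that assms(2,5,6) by (intro polyfun_sym_prod) auto
  moreover have "finite (Id_on V \<union> {(a, b)})"
    using fV by (auto simp: Id_on_def)
  ultimately have "lin_indep_family (Id_on V \<union> {(a, b)})
      (\<lambda>e ij. sym_prod d (\<lambda>w j. (case (w, j) of (w, j) \<Rightarrow> p w j)) e ij)"
    using lin_indep_family_generic[where V = "\<lambda>e ij x. sym_prod d (\<lambda>w j. x (w, j)) e ij"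
        and I = "coord_index d n" and x = "\<lambda>(v, j). p v j" and y = "\<lambda>(v, j). h v j"
        and F = "Id_on V \<union> {(a, b)}"]
    by (simp add: coord_index_def)
  then show ?thesis by simp
qed

section \<open>Stresses\<close>

lemma homogeneous_system:
  fixes M :: "'i \<Rightarrow> 'j \<Rightarrow> real"
  assumes "finite J" "finite I" "card J < card I"
  shows "\<exists>x. (\<exists>i\<in>I. x i \<noteq> 0) \<and> (\<forall>j\<in>J. (\<Sum>i\<in>I. x i * M i j) = 0)"
  using assms
proof (induction J arbitrary: I M rule: finite_induct)
  case empty
  then have "I \<noteq> {}" by auto
  then show ?case by (intro exI[of _ "\<lambda>_. 1"]) auto
next
  case (insert j J)
  show ?case
  proof (cases "\<forall>i\<in>I. M i j = 0")
    case True
    have "card J < card I" using insert by simp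
    from insert.IH[OF insert.prems(1) this] obtain x where
      "\<exists>i\<in>I. x i \<noteq> 0" "\<forall>j\<in>J. (\<Sum>i\<in>I. x i * M i j) = 0" by blast
    with True show ?thesis by (intro exI[of _ x]) auto
  next
    case False
    then obtain i0 where i0: "i0 \<in> I" "M i0 j \<noteq> 0" by blast
    define I' where "I' = I - {i0}"
    have I: "I = insert i0 I'" "i0 \<notin> I'" "finite I'"
      using i0 insert.prems by (auto simp: I'_def)
    have "card J < card I'" using insert.prems insert.hyps I by simp
    from insert.IH[OF I(3) this, of "\<lambda>i k. M i k - M i j / M i0 j * M i0 k"] obtain x
      where x: "\<exists>i\<in>I'. x i \<noteq> 0"
        "\<And>k. k \<in> J \<Longrightarrow> (\<Sum>i\<in>I'. x i * (M i k - M i j / M i0 j * M i0 k)) = 0"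
      by blast
    define y where "y i = (if i = i0 then - (\<Sum>i\<in>I'. x i * M i j) / M i0 j else x i)" for i
    have y: "(\<Sum>i\<in>I. y i * M i k) = (\<Sum>i\<in>I'. x i * M i k) - (\<Sum>i\<in>I'. x i * M i j) / M i0 j * M i0 k" for k
    proof -
      have "(\<Sum>i\<in>I'. y i * M i k) = (\<Sum>i\<in>I'. x i * M i k)"
        using I by (intro sum.cong) (auto simp: y_def)
      then show ?thesis using I by (simp add: y_def)
    qed
    have "(\<Sum>i\<in>I. y i * M i k) = 0" if "k \<in> insert j J" for k
    proof (cases "k = j")
      case True
      then show ?thesis using i0 unfolding y by simp
    next
      case False
      then show ?thesis
        using x(2)[of k] that unfolding y
        by (simp add: right_diff_distrib sum_subtractf sum_divide_distrib sum_distrib_right mult.assoc)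
    qed
    moreover have "\<exists>i\<in>I. y i \<noteq> 0" using x(1) I by (auto simp: y_def)
    ultimately show ?thesis by blast
  qed
qed

lemma affine_dependency_exists:
  assumes "finite S" "d + 1 < card S"
  shows "\<exists>\<gamma>. (\<exists>v\<in>S. \<gamma> v \<noteq> 0) \<and> (\<forall>i. (\<Sum>v\<in>S. \<gamma> v * hat d p v i) = 0)"
proof -
  obtain \<gamma> where \<gamma>: "\<exists>v\<in>S. \<gamma> v \<noteq> 0" "\<forall>i\<in>{..d}. (\<Sum>v\<in>S. \<gamma> v * hat d p v i) = 0"
    using homogeneous_system[of "{..d}" S "hat d p"] assms by auto
  have "(\<Sum>v\<in>S. \<gamma> v * hat d p v i) = 0" for i
    using \<gamma>(2) by (cases "i \<le> d") (auto simp: hat_def)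
  then show ?thesis using \<gamma>(1) by blast
qed

text \<open>A dependency that vanishes at one point is a dependency of the remaining independent
  points, hence zero. So a nonzero one vanishes nowhere, and subtracting the multiple that cancels a
  single value cancels any other dependency completely.\<close>

lemma circuit_dependency:
  assumes "finite S" "card S = d + 2"
    and ind: "\<And>v. v \<in> S \<Longrightarrow> lin_indep_family (S - {v}) (hat d p)"
  shows "\<exists>\<alpha>. (\<forall>v\<in>S. \<alpha> v \<noteq> 0) \<and> (\<forall>i. (\<Sum>v\<in>S. \<alpha> v * hat d p v i) = 0) \<and>
    (\<forall>\<gamma>. (\<forall>i. (\<Sum>v\<in>S. \<gamma> v * hat d p v i) = 0) \<longrightarrow> (\<exists>c. \<forall>v\<in>S. \<gamma> v = c * \<alpha> v))"
proof -
  have vanish: "\<gamma> v = 0" if "\<And>i. (\<Sum>v\<in>S. \<gamma> v * hat d p v i) = 0" "w \<in> S" "\<gamma> w = 0" "v \<in> S" for \<gamma> v w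
  proof (cases "v = w")
    case False
    have "(\<Sum>v\<in>S - {w}. \<gamma> v * hat d p v i) = 0" for i
      using that(1)[of i] assms(1) that(2,3) by (simp add: sum.remove)
    from lin_indep_familyD[OF ind[OF that(2)] this] show ?thesis using that(4) False by blast
  qed (use that in simp)
  obtain \<alpha> where \<alpha>: "\<exists>v\<in>S. \<alpha> v \<noteq> 0" "\<And>i. (\<Sum>v\<in>S. \<alpha> v * hat d p v i) = 0"
    using affine_dependency_exists[of S d p] assms by auto
  have nz: "\<alpha> v \<noteq> 0" if "v \<in> S" for v using vanish[OF \<alpha>(2) that] \<alpha>(1) by blast
  have "\<exists>c. \<forall>v\<in>S. \<gamma> v = c * \<alpha> v" if "\<forall>i. (\<Sum>v\<in>S. \<gamma> v * hat d p v i) = 0" for \<gamma>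
  proof -
    have \<gamma>: "(\<Sum>v\<in>S. \<gamma> v * hat d p v i) = 0" for i using that by blast
    obtain w where w: "w \<in> S" using \<alpha>(1) by blast
    define c where "c = \<gamma> w / \<alpha> w"
    have "(\<Sum>v\<in>S. (\<gamma> v - c * \<alpha> v) * hat d p v i) = 0" for i
    proof -
      have "(\<Sum>v\<in>S. (\<gamma> v - c * \<alpha> v) * hat d p v i) =
          (\<Sum>v\<in>S. \<gamma> v * hat d p v i) - c * (\<Sum>v\<in>S. \<alpha> v * hat d p v i)"
        by (simp add: left_diff_distrib sum_subtractf sum_distrib_left mult.assoc)
      then show ?thesis using \<gamma> \<alpha>(2) by simp
    qed
    from vanish[OF this w] have "\<gamma> v - c * \<alpha> v = 0" if "v \<in> S" for v
      using that nz[OF w] by (simp add: c_def)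
    then show "\<exists>c. \<forall>v\<in>S. \<gamma> v = c * \<alpha> v" by (intro exI[of _ c]) auto
  qed
  then show ?thesis using nz \<alpha>(2) by blast
qed

text \<open>Barycentric coordinates sum to 1, so a linear dependency among them has coefficient sum
  0 and survives translation by \<open>p w\<close>. Rows of the rigidity matrix contain just such
  differences.\<close>

lemma affine_dependency_differences:
  assumes "\<And>i. (\<Sum>v\<in>S. \<gamma> v * hat d p v i) = 0" "j < d"
  shows "(\<Sum>v\<in>S. \<gamma> v * (p w j - p v j)) = 0"
proof -
  have "(\<Sum>v\<in>S. \<gamma> v) = (\<Sum>v\<in>S. \<gamma> v * (\<Sum>i\<le>d. hat d p v i))" by (simp add: sum_hat)
  also have "\<dots> = (\<Sum>i\<le>d. \<Sum>v\<in>S. \<gamma> v * hat d p v i)"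
    by (subst sum.swap) (simp add: sum_distrib_left)
  also have "\<dots> = 0" using assms(1) by simp
  finally have "(\<Sum>v\<in>S. \<gamma> v) = 0" .
  moreover have "(\<Sum>v\<in>S. \<gamma> v * p v j) = 0" using assms(1)[of j] assms(2) by (simp add: hat_def)
  ultimately show ?thesis
    by (simp add: right_diff_distrib sum_subtractf sum_distrib_right[symmetric])
qed

section \<open>Rows of the rigidity matrix and equilibrium at a vertex\<close>

lemma finite_Kn_edges: "finite (Kn_edges n)"
  by (rule finite_subset[of _ "Pow {..<n}"]) (auto simp: Kn_edges_def)

lemma Kn_edges_doubleton: "{u, v} \<in> Kn_edges n \<longleftrightarrow> u < n \<and> v < n \<and> u \<noteq> v"
  by (auto simp: Kn_edges_def doubleton_eq_iff)

text \<open>A linear combination of the rows indexed by \<open>F\<close>, read as a symmetric matrix.\<close>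

definition edge_weight :: "'v set set \<Rightarrow> ('v set \<Rightarrow> real) \<Rightarrow> 'v \<Rightarrow> 'v \<Rightarrow> real" where
  "edge_weight F c u v = (if {u, v} \<in> F then c {u, v} else 0)"

lemma edge_weight_commute: "edge_weight F c u v = edge_weight F c v u"
  by (simp add: edge_weight_def insert_commute)

text \<open>The set \<open>N\<close> may exceed the neighbourhood of \<open>w\<close>, so that one
  vertex set serves many vertices at once.\<close>

lemma row_combination:
  assumes F: "F \<subseteq> Kn_edges n" and N: "finite N" "{u. {w, u} \<in> F} \<subseteq> N" and j: "j < d"
  shows "(\<Sum>e\<in>F. c e * rigidity_row d p e (w, j)) =
    (\<Sum>u\<in>N. edge_weight F c w u * (p w j - p u j))"
proof -
  let ?M = "{u. {w, u} \<in> F}"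
  have inj: "inj_on (\<lambda>u. {w, u}) ?M" by (auto intro!: inj_onI simp: doubleton_eq_iff)
  have img: "(\<lambda>u. {w, u}) ` ?M = {e\<in>F. w \<in> e}"
    using F by (force simp: Kn_edges_def insert_commute)
  have row: "rigidity_row d p {w, u} (w, j) = p w j - p u j" if "u \<in> ?M" for u
  proof -
    have "u \<noteq> w" using that F Kn_edges_doubleton[of w u n] by auto
    then have "{w, u} - {w} = {u}" by auto
    then show ?thesis using j by (simp add: rigidity_row_def)
  qed
  have "(\<Sum>e\<in>F. c e * rigidity_row d p e (w, j)) = (\<Sum>e\<in>{e\<in>F. w \<in> e}. c e * rigidity_row d p e (w, j))"
    using finite_subset[OF F finite_Kn_edges] by (intro sum.mono_neutral_right) (auto simp: rigidity_row_def)
  also have "\<dots> = (\<Sum>u\<in>?M. c {w, u} * rigidity_row d p {w, u} (w, j))"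
    unfolding img[symmetric] using inj by (simp add: sum.reindex)
  also have "\<dots> = (\<Sum>u\<in>?M. edge_weight F c w u * (p w j - p u j))"
    using row by (intro sum.cong) (auto simp: edge_weight_def)
  also have "\<dots> = (\<Sum>u\<in>N. edge_weight F c w u * (p w j - p u j))"
    using N by (intro sum.mono_neutral_left) (auto simp: edge_weight_def)
  finally show ?thesis .
qed

definition stress :: "nat \<Rightarrow> (nat \<Rightarrow> nat \<Rightarrow> real) \<Rightarrow> nat set set \<Rightarrow> (nat set \<Rightarrow> real) \<Rightarrow> bool" where
  "stress d p F c \<longleftrightarrow> (\<forall>i. (\<Sum>e\<in>F. c e * rigidity_row d p e i) = 0)"

text \<open>The rows give the first d coordinates. The last barycentric coordinate is an affine
  function of these, and the identity respects affine functions because the same total weight stands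
  on the right.\<close>

lemma stress_equilibrium:
  assumes "F \<subseteq> Kn_edges n" "stress d p F c" "finite N" "{u. {w, u} \<in> F} \<subseteq> N"
  shows "(\<Sum>u\<in>N. edge_weight F c w u * hat d p u i) = (\<Sum>u\<in>N. edge_weight F c w u) * hat d p w i"
proof -
  have *: "(\<Sum>u\<in>N. edge_weight F c w u * p u j) = (\<Sum>u\<in>N. edge_weight F c w u) * p w j" if "j < d" for j
  proof -
    have "(\<Sum>u\<in>N. edge_weight F c w u * (p w j - p u j)) = 0"
      using row_combination[OF assms(1,3,4) that, of c p] assms(2) by (simp add: stress_def)
    then show ?thesis
      by (simp add: right_diff_distrib sum_subtractf sum_distrib_right[symmetric])
  qed
  consider "i < d" | "i = d" | "i > d" by linarith
  then show ?thesis
  proof cases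
    case 2
    have "(\<Sum>u\<in>N. edge_weight F c w u * (\<Sum>j<d. p u j)) = (\<Sum>j<d. \<Sum>u\<in>N. edge_weight F c w u * p u j)"
      by (subst sum.swap) (simp add: sum_distrib_left)
    also have "\<dots> = (\<Sum>u\<in>N. edge_weight F c w u) * (\<Sum>j<d. p w j)"
      by (simp add: * sum_distrib_left)
    finally show ?thesis
      using 2 by (simp add: hat_def right_diff_distrib sum_subtractf)
  qed (simp_all add: hat_def *)
qed

text \<open>With edge weights \<gamma> u * \<gamma> v the factor \<gamma> w comes out of the
  equilibrium condition at \<open>w\<close>, which then says that \<gamma> is an affine dependency
  of the neighbours of \<open>w\<close>. The edge \<open>e\<close> makes the stress nonzero.\<close>

lemma product_stress_dependent:
  assumes F: "F \<subseteq> Kn_edges n" "G \<subseteq> F" and e: "e \<in> G" "\<And>v. v \<in> e \<Longrightarrow> \<gamma> v \<noteq> 0"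
    and eq: "\<And>w j. w \<in> \<Union>G \<Longrightarrow> j < d \<Longrightarrow> (\<Sum>u\<in>{u. {w, u} \<in> G}. \<gamma> u * (p w j - p u j)) = 0"
  shows "\<not> lin_indep_family F (rigidity_row d p)"
proof
  assume ind: "lin_indep_family F (rigidity_row d p)"
  have fF: "finite F" using F(1) finite_Kn_edges finite_subset by blast
  have G: "G \<subseteq> Kn_edges n" using F by blast
  define c where "c e = (if e \<in> G then \<Prod>v\<in>e. \<gamma> v else 0)" for e
  have zero: "(\<Sum>e\<in>F. c e * rigidity_row d p e i) = 0" for i
  proof -
    obtain w j where i: "i = (w, j)" by fastforce
    have "(\<Sum>e\<in>F. c e * rigidity_row d p e i) = (\<Sum>e\<in>G. c e * rigidity_row d p e i)"
      using fF F(2) by (intro sum.mono_neutral_right) (auto simp: c_def)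
    also have "\<dots> = 0"
    proof (cases "j < d \<and> w \<in> \<Union>G")
      case True
      have sub: "{u. {w, u} \<in> G} \<subseteq> {..<n}" using G by (auto simp: Kn_edges_doubleton)
      have "(\<Sum>e\<in>G. c e * rigidity_row d p e (w, j)) =
          (\<Sum>u\<in>{u. {w, u} \<in> G}. edge_weight G c w u * (p w j - p u j))"
        using G True sub finite_subset by (intro row_combination) auto
      also have "\<dots> = (\<Sum>u\<in>{u. {w, u} \<in> G}. \<gamma> w * (\<gamma> u * (p w j - p u j)))"
      proof (intro sum.cong refl)
        fix u assume "u \<in> {u. {w, u} \<in> G}"
        then have "edge_weight G c w u = \<gamma> w * \<gamma> u"
          using G Kn_edges_doubleton[of w u n] by (auto simp: edge_weight_def c_def)
        then show "edge_weight G c w u * (p w j - p u j) = \<gamma> w * (\<gamma> u * (p w j - p u j))" by simp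
      qed
      also have "\<dots> = 0" using eq True by (simp add: sum_distrib_left[symmetric])
      finally show ?thesis unfolding i .
    next
      case False
      then show ?thesis unfolding i by (intro sum.neutral) (auto simp: rigidity_row_def)
    qed
    finally show ?thesis .
  qed
  have "finite e" using e(1) G by (auto simp: Kn_edges_def)
  then have "c e \<noteq> 0" using e by (simp add: c_def)
  then show False using lin_indep_familyD[OF ind zero, of e] e(1) F(2) by blast
qed

text \<open>An edge without weight in any stress is a coloop, so adding it to a largest independent
  subset of \<open>X\<close> keeps independence.\<close>

lemma row_rank_insert:
  assumes "finite X" "e \<notin> X" "\<And>c. stress d p (insert e X) c \<Longrightarrow> c e = 0"
  shows "row_rank d p (insert e X) \<noteq> row_rank d p X"
proof -
  let ?I = "\<lambda>X. {Y. Y \<subseteq> X \<and> finite Y \<and> lin_indep_family Y (rigidity_row d p)}"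
  have fin: "finite (?I Z)" if "finite Z" for Z using that by simp
  have "{} \<in> ?I X" by (simp add: lin_indep_family_def)
  then have "row_rank d p X \<in> card ` ?I X"
    unfolding row_rank_def using fin[OF assms(1)] by (intro Max_in) auto
  then obtain Y where Y: "Y \<subseteq> X" "finite Y" "lin_indep_family Y (rigidity_row d p)"
    "card Y = row_rank d p X" by auto
  have "lin_indep_family (insert e Y) (rigidity_row d p)"
  proof (rule lin_indep_familyI)
    fix c f assume 0: "\<And>i. (\<Sum>f\<in>insert e Y. c f * rigidity_row d p f i) = 0" and f: "f \<in> insert e Y"
    \<comment> \<open>Extension by zero turns a dependency on \<open>insert e Y\<close> into a
      stress of \<open>insert e X\<close>.\<close>
    define c' where "c' f = (if f \<in> insert e Y then c f else 0)" for f
    have "(\<Sum>f\<in>insert e X. c' f * rigidity_row d p f i) = (\<Sum>f\<in>insert e Y. c f * rigidity_row d p f i)" for i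
      using Y assms(1) by (intro sum.mono_neutral_cong_right) (auto simp: c'_def)
    then have "stress d p (insert e X) c'" using 0 by (simp add: stress_def)
    then have ce: "c e = 0" using assms(3)[of c'] by (simp add: c'_def)
    have "e \<notin> Y" using Y assms(2) by blast
    then have "(\<Sum>f\<in>Y. c f * rigidity_row d p f i) = 0" for i using 0[of i] Y(2) ce by simp
    from lin_indep_familyD[OF Y(3) this] show "c f = 0" using f ce by auto
  qed
  then have "card (insert e Y) \<in> card ` ?I (insert e X)" using Y by auto
  then have "card (insert e Y) \<le> row_rank d p (insert e X)"
    unfolding row_rank_def using fin[of "insert e X"] assms(1) by (intro Max_ge) auto
  moreover have "card (insert e Y) = Suc (row_rank d p X)"
    using Y assms(2) by (subst card_insert_disjoint) auto
  ultimately show ?thesis by linarith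
qed

text \<open>Equilibrium at \<open>u\<close> has a single term, so a nonzero weight would force the
  two end points to coincide.\<close>

lemma stress_pendant_edge:
  assumes "insert {u, v} X \<subseteq> Kn_edges n" "\<And>e. e \<in> X \<Longrightarrow> u \<notin> e"
    and ind: "lin_indep_family {u, v} (hat d p)"
    and c: "stress d p (insert {u, v} X) c"
  shows "c {u, v} = 0"
proof -
  let ?F = "insert {u, v} X"
  have uv: "u \<noteq> v" using assms(1) by (simp add: Kn_edges_doubleton)
  have "{w. {u, w} \<in> ?F} \<subseteq> {v}" using assms(2) by (auto simp: doubleton_eq_iff)
  from stress_equilibrium[OF assms(1) c _ this]
  have eq: "c {u, v} * hat d p v i = c {u, v} * hat d p u i" for i
    by (simp add: edge_weight_def)
  have "(\<Sum>w\<in>{u, v}. (if w = u then c {u, v} else - c {u, v}) * hat d p w i) = 0" for i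
    using eq[of i] uv by auto
  from lin_indep_familyD[OF ind this, of u] show ?thesis by simp
qed

section \<open>The complete bipartite graph with disjoint cliques\<close>

text \<open>For fixed \<open>b\<close> the weights form a dependency of \<open>A\<close>, hence a
  multiple t b of the unique one. Dividing the conditions at a single point of \<open>A\<close> by
  its nonzero \<alpha> shows that t is a dependency of \<open>B\<close>.\<close>

lemma rank_one_bipartite:
  fixes \<omega> :: "nat \<Rightarrow> nat \<Rightarrow> real"
  assumes A: "A \<noteq> {}"
    and \<alpha>: "\<And>a. a \<in> A \<Longrightarrow> \<alpha> a \<noteq> 0"
      "\<And>\<gamma>. (\<And>i. (\<Sum>v\<in>A. \<gamma> v * hat d p v i) = 0) \<Longrightarrow> \<exists>c. \<forall>v\<in>A. \<gamma> v = c * \<alpha> v"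
    and \<omega>B: "\<And>b i. b \<in> B \<Longrightarrow> (\<Sum>a\<in>A. \<omega> a b * hat d p a i) = 0"
    and \<omega>A: "\<And>a i. a \<in> A \<Longrightarrow> (\<Sum>b\<in>B. \<omega> a b * hat d p b i) = 0"
  shows "\<exists>t. (\<forall>a\<in>A. \<forall>b\<in>B. \<omega> a b = t b * \<alpha> a) \<and> (\<forall>i. (\<Sum>b\<in>B. t b * hat d p b i) = 0)"
proof -
  have "\<exists>c. \<forall>a\<in>A. \<omega> a b = c * \<alpha> a" if "b \<in> B" for b
    using \<alpha>(2)[of "\<lambda>a. \<omega> a b"] \<omega>B[OF that] by blast
  then obtain t where t: "\<And>a b. b \<in> B \<Longrightarrow> a \<in> A \<Longrightarrow> \<omega> a b = t b * \<alpha> a" by metis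
  obtain a where a: "a \<in> A" using A by blast
  have "(\<Sum>b\<in>B. t b * hat d p b i) = 0" for i
  proof -
    have "(\<Sum>b\<in>B. \<omega> a b * hat d p b i) = (\<Sum>b\<in>B. \<alpha> a * (t b * hat d p b i))"
      using t a by (intro sum.cong) auto
    also have "\<dots> = \<alpha> a * (\<Sum>b\<in>B. t b * hat d p b i)" by (simp add: sum_distrib_left)
    finally show ?thesis using \<omega>A[OF a] \<alpha>(1)[OF a] by simp
  qed
  with t show ?thesis by blast
qed

text \<open>Genericity enters only through \<open>points\<close> and \<open>squares\<close>. The
  latter admits one product of two points of \<open>A\<close>, which covers an edge added inside
  \<open>A\<close>.\<close>

locale bipartite_and_cliques =
  fixes d n m :: nat and p :: "nat \<Rightarrow> nat \<Rightarrow> real"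
    and A B :: "nat set" and C :: "nat \<Rightarrow> nat set"
  assumes vertices: "{..<n} = A \<union> B \<union> (\<Union>i<m. C i)"
    and AB: "A \<inter> B = {}"
    and AC: "i < m \<Longrightarrow> A \<inter> C i = {}"
    and BC: "i < m \<Longrightarrow> B \<inter> C i = {}"
    and CC: "i < m \<Longrightarrow> j < m \<Longrightarrow> i \<noteq> j \<Longrightarrow> C i \<inter> C j = {}"
    and cards: "card A = d + 2" "card B = d + 3" "i < m \<Longrightarrow> card (C i) = d + 2"
    and points: "S \<subseteq> {..<n} \<Longrightarrow> card S \<le> d + 1 \<Longrightarrow> lin_indep_family S (hat d p)"
    and squares: "a \<in> A \<Longrightarrow> b \<in> A \<Longrightarrow> a \<noteq> b \<Longrightarrow>
      lin_indep_family (Id_on (A \<union> B) \<union> {(a, b)}) (sym_prod d p)"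
    and d_pos: "0 < d"
begin

section \<open>The circuit and its parts\<close>

definition star :: "nat \<Rightarrow> nat set set" where
  "star b = (\<lambda>a. {a, b}) ` A"

definition clique :: "nat \<Rightarrow> nat set set" where
  "clique i = {{u, v} | u v. u \<in> C i \<and> v \<in> C i \<and> u \<noteq> v}"

text \<open>The sum type indexes stars and cliques by one family: the \<open>Inl\<close> indices
  play the role of \<open>J\<close> and the \<open>Inr\<close> indices that of \<open>K\<close> in
  \<open>kfold_circuit_partition\<close>.\<close>

definition part :: "nat + nat \<Rightarrow> nat set set" where
  "part = case_sum star clique"

definition D :: "nat set set" where
  "D = (\<Union>b\<in>B. star b) \<union> (\<Union>i<m. clique i)"

lemma less_n: "a \<in> A \<Longrightarrow> a < n" "b \<in> B \<Longrightarrow> b < n" "i < m \<Longrightarrow> u \<in> C i \<Longrightarrow> u < n"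
  using vertices by blast+

lemma finite_vertices: "finite A" "finite B" "i < m \<Longrightarrow> finite (C i)"
  using less_n by (auto intro: finite_subset[of _ "{..<n}"])

lemma D_edges: "D \<subseteq> Kn_edges n"
proof -
  have "star b \<subseteq> Kn_edges n" if "b \<in> B" for b
    using that less_n AB by (auto simp: star_def Kn_edges_doubleton)
  moreover have "clique i \<subseteq> Kn_edges n" if "i < m" for i
    using that less_n by (auto simp: clique_def Kn_edges_doubleton)
  ultimately show ?thesis unfolding D_def by blast
qed

lemma finite_D: "finite D"
  using D_edges finite_Kn_edges finite_subset by blast

lemma doubleton_D:
  "{u, v} \<in> D \<longleftrightarrow> u \<in> A \<and> v \<in> B \<or> u \<in> B \<and> v \<in> A \<or> (\<exists>i<m. u \<in> C i \<and> v \<in> C i \<and> u \<noteq> v)"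
proof -
  have "{u, v} \<in> star b \<longleftrightarrow> u \<in> A \<and> v = b \<or> u = b \<and> v \<in> A" for b
    by (auto simp: star_def doubleton_eq_iff)
  moreover have "{u, v} \<in> clique i \<longleftrightarrow> u \<in> C i \<and> v \<in> C i \<and> u \<noteq> v" for i
    by (auto simp: clique_def doubleton_eq_iff)
  ultimately show ?thesis unfolding D_def by auto
qed

lemma D_neighbours:
  assumes "{u, v} \<in> D"
  shows "u \<in> A \<Longrightarrow> v \<in> B" "u \<in> B \<Longrightarrow> v \<in> A" "i < m \<Longrightarrow> u \<in> C i \<Longrightarrow> v \<in> C i"
proof -
  show "v \<in> B" if "u \<in> A" using assms that AB AC unfolding doubleton_D by blast
  show "v \<in> A" if "u \<in> B" using assms that AB BC unfolding doubleton_D by blast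
  show "v \<in> C i" if i: "i < m" "u \<in> C i"
  proof -
    have "u \<notin> A" "u \<notin> B" using AC[OF i(1)] BC[OF i(1)] i(2) by auto
    then obtain j where j: "j < m" "u \<in> C j" "v \<in> C j" using assms unfolding doubleton_D by blast
    then have "j = i" using CC[OF i(1) j(1)] i(2) by blast
    then show ?thesis using j by simp
  qed
qed

text \<open>Tensoring the equilibrium conditions of a complete bipartite graph with the vertex
  coordinates yields a linear relation between the squares of the points (and the product of the
  ends of the additional edge), as in the theorem of Bolker and Roth.\<close>

lemma stress_squares_vanish:
  assumes F: "F \<subseteq> insert {a1, a2} D" and a: "a1 \<in> A" "a2 \<in> A" "a1 \<noteq> a2" and c: "stress d p F c"
  defines "\<omega> \<equiv> edge_weight F c"
  shows "\<omega> a1 a2 = 0" "\<And>w. w \<in> A \<union> B \<Longrightarrow> (\<Sum>u\<in>A \<union> B. \<omega> w u) = 0"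
proof -
  let ?V = "A \<union> B"
  define \<rho> where "\<rho> w = (\<Sum>u\<in>?V. \<omega> w u)" for w
  have FK: "F \<subseteq> Kn_edges n" using F D_edges a less_n by (auto simp: Kn_edges_doubleton)
  have fin: "finite A" "finite B" by (rule finite_vertices)+
  \<comment> \<open>The additional edge stays inside \<open>A\<close>, so the neighbours of
    \<open>A \<union> B\<close> stay in \<open>A \<union> B\<close> and the cliques do not
    interfere.\<close>
  have N: "{u. {w, u} \<in> F} \<subseteq> ?V" if "w \<in> ?V" for w
    using F a that D_neighbours[of w] by (auto simp: doubleton_eq_iff)
  have eqw: "(\<Sum>u\<in>?V. \<omega> w u * hat d p u i) = \<rho> w * hat d p w i" if "w \<in> ?V" for w i
    unfolding \<omega>_def \<rho>_def using stress_equilibrium[OF FK c _ N[OF that]] fin by simp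
  have split: "sum f ?V = sum f A + sum f B" for f :: "nat \<Rightarrow> real"
    using fin AB by (rule sum.union_disjoint)
  have \<omega>BB: "\<omega> b b' = 0" if "b \<in> B" "b' \<in> B" for b b'
  proof -
    have "{b, b'} \<noteq> {a1, a2}" using that a AB by (auto simp: doubleton_eq_iff)
    moreover have "{b, b'} \<notin> D" using that AB D_neighbours(2)[of b b'] by blast
    ultimately have "{b, b'} \<notin> F" using F by blast
    then show ?thesis by (simp add: \<omega>_def edge_weight_def)
  qed
  have \<omega>AA: "\<omega> x y = 0" if "x \<in> A" "y \<in> A" "(x, y) \<noteq> (a1, a2)" "(x, y) \<noteq> (a2, a1)" for x y
  proof -
    have "{x, y} \<noteq> {a1, a2}" using that by (auto simp: doubleton_eq_iff)
    moreover have "{x, y} \<notin> D" using that AB D_neighbours(1)[of x y] by blast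
    ultimately have "{x, y} \<notin> F" using F by blast
    then show ?thesis by (simp add: \<omega>_def edge_weight_def)
  qed
  have comm: "\<omega> x y = \<omega> y x" for x y unfolding \<omega>_def by (rule edge_weight_commute)
  \<comment> \<open>Inside \<open>A\<close> only the additional edge can carry weight, and its two
    orientations produce the symmetrised product.\<close>
  have AA: "(\<Sum>x\<in>A. \<Sum>y\<in>A. \<omega> x y * hat d p y i * hat d p x j) = \<omega> a1 a2 * sym_prod d p (a1, a2) (i, j)"
    for i j
  proof -
    have "(\<Sum>x\<in>A. \<Sum>y\<in>A. \<omega> x y * hat d p y i * hat d p x j) =
        (\<Sum>(x, y)\<in>A \<times> A. \<omega> x y * hat d p y i * hat d p x j)"
      by (rule sum.cartesian_product)
    also have "\<dots> = (\<Sum>(x, y)\<in>{(a1, a2), (a2, a1)}. \<omega> x y * hat d p y i * hat d p x j)"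
    proof (intro sum.mono_neutral_right ballI)
      fix xy assume xy: "xy \<in> A \<times> A - {(a1, a2), (a2, a1)}"
      obtain x y where "xy = (x, y)" by fastforce
      with xy \<omega>AA[of x y] show "(case xy of (x, y) \<Rightarrow> \<omega> x y * hat d p y i * hat d p x j) = 0" by auto
    qed (use a fin in auto)
    also have "\<dots> = \<omega> a1 a2 * sym_prod d p (a1, a2) (i, j)"
      using a(3) comm[of a2 a1] by (simp add: sym_prod_def algebra_simps)
    finally show ?thesis .
  qed
  \<comment> \<open>Equilibrium at the points of \<open>A\<close> expands the right-hand side; after
    exchanging the sums, equilibrium at the points of \<open>B\<close> collects the bipartite terms
    into squares of \<open>B\<close>.\<close>
  have key: "\<omega> a1 a2 * sym_prod d p (a1, a2) (i, j) + (\<Sum>b\<in>B. \<rho> b * hat d p b j * hat d p b i) =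
      (\<Sum>x\<in>A. \<rho> x * hat d p x i * hat d p x j)" for i j
  proof -
    have "(\<Sum>x\<in>A. \<rho> x * hat d p x i * hat d p x j) =
        (\<Sum>x\<in>A. (\<Sum>y\<in>A. \<omega> x y * hat d p y i * hat d p x j) + (\<Sum>b\<in>B. \<omega> x b * hat d p b i * hat d p x j))"
    proof (intro sum.cong refl)
      fix x assume "x \<in> A"
      then have "\<rho> x * hat d p x i * hat d p x j = (\<Sum>u\<in>?V. \<omega> x u * hat d p u i) * hat d p x j"
        by (simp add: eqw)
      then show "\<rho> x * hat d p x i * hat d p x j =
        (\<Sum>y\<in>A. \<omega> x y * hat d p y i * hat d p x j) + (\<Sum>b\<in>B. \<omega> x b * hat d p b i * hat d p x j)"
        by (simp add: split distrib_right sum_distrib_right)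
    qed
    also have "\<dots> = \<omega> a1 a2 * sym_prod d p (a1, a2) (i, j) +
        (\<Sum>x\<in>A. \<Sum>b\<in>B. \<omega> x b * hat d p b i * hat d p x j)"
      by (simp add: sum.distrib AA)
    also have "(\<Sum>x\<in>A. \<Sum>b\<in>B. \<omega> x b * hat d p b i * hat d p x j) =
        (\<Sum>b\<in>B. \<Sum>x\<in>A. \<omega> x b * hat d p b i * hat d p x j)" by (rule sum.swap)
    also have "\<dots> = (\<Sum>b\<in>B. \<rho> b * hat d p b j * hat d p b i)"
    proof (intro sum.cong refl)
      fix b assume b: "b \<in> B"
      have "(\<Sum>u\<in>?V. \<omega> b u * hat d p u j) = (\<Sum>x\<in>A. \<omega> b x * hat d p x j)"
        using \<omega>BB[OF b] by (simp add: split)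
      then have "\<rho> b * hat d p b j * hat d p b i = (\<Sum>x\<in>A. \<omega> b x * hat d p x j) * hat d p b i"
        using eqw[of b j] b by simp
      also have "\<dots> = (\<Sum>x\<in>A. \<omega> x b * hat d p b i * hat d p x j)"
        by (simp add: sum_distrib_left comm[of b] ac_simps)
      finally show "(\<Sum>x\<in>A. \<omega> x b * hat d p b i * hat d p x j) = \<rho> b * hat d p b j * hat d p b i" ..
    qed
    finally show ?thesis by simp
  qed
  define g where "g e = (if e = (a1, a2) then 2 * \<omega> a1 a2 else if fst e \<in> A then - \<rho> (fst e) else \<rho> (fst e))"
    for e
  have "(\<Sum>e\<in>Id_on ?V \<union> {(a1, a2)}. g e * sym_prod d p e ij) = 0" for ij
  proof -
    obtain i j where ij: "ij = (i, j)" by fastforce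
    have "(\<Sum>v\<in>A. g (v, v) * sym_prod d p (v, v) ij) = - 2 * (\<Sum>x\<in>A. \<rho> x * hat d p x i * hat d p x j)"
      unfolding sum_distrib_left using a(3) by (intro sum.cong) (auto simp: g_def sym_prod_def ij)
    moreover have "(\<Sum>v\<in>B. g (v, v) * sym_prod d p (v, v) ij) = 2 * (\<Sum>b\<in>B. \<rho> b * hat d p b j * hat d p b i)"
      unfolding sum_distrib_left using a(3) AB by (intro sum.cong) (auto simp: g_def sym_prod_def ij)
    ultimately show ?thesis
      using fin key[of i j] unfolding sum_Id_on_insert[OF finite_UnI[OF fin] a(3)] split
      by (simp add: g_def ij)
  qed
  from lin_indep_familyD[OF squares[OF a] this]
  have g0: "g e = 0" if "e \<in> Id_on ?V \<union> {(a1, a2)}" for e using that by blast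
  show "\<omega> a1 a2 = 0" using g0[of "(a1, a2)"] by (simp add: g_def)
  show "(\<Sum>u\<in>A \<union> B. \<omega> w u) = 0" if "w \<in> A \<union> B" for w
  proof -
    have "g (w, w) = 0" using that by (intro g0) auto
    then show ?thesis using a(3) by (auto simp: g_def \<rho>_def split: if_splits)
  qed
qed

section \<open>Shape of the stresses on the bipartite part and on the cliques\<close>

lemma stress_zero_on_A_edge:
  assumes "F \<subseteq> insert {a1, a2} D" "a1 \<in> A" "a2 \<in> A" "a1 \<noteq> a2" "stress d p F c" "{a1, a2} \<in> F"
  shows "c {a1, a2} = 0"
  using stress_squares_vanish(1)[OF assms(1-5)] assms(6) by (simp add: edge_weight_def)

lemma dependency_A: "\<exists>\<alpha>. (\<forall>v\<in>A. \<alpha> v \<noteq> 0) \<and> (\<forall>i. (\<Sum>v\<in>A. \<alpha> v * hat d p v i) = 0) \<and>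
    (\<forall>\<gamma>. (\<forall>i. (\<Sum>v\<in>A. \<gamma> v * hat d p v i) = 0) \<longrightarrow> (\<exists>c. \<forall>v\<in>A. \<gamma> v = c * \<alpha> v))"
proof (rule circuit_dependency[of A d p])
  fix v assume "v \<in> A"
  then show "lin_indep_family (A - {v}) (hat d p)"
    using cards(1) finite_vertices(1) less_n by (intro points) auto
qed (use cards finite_vertices in auto)

lemma dependency_C:
  assumes "i < m"
  shows "\<exists>\<alpha>. (\<forall>v\<in>C i. \<alpha> v \<noteq> 0) \<and> (\<forall>j. (\<Sum>v\<in>C i. \<alpha> v * hat d p v j) = 0) \<and>
    (\<forall>\<gamma>. (\<forall>j. (\<Sum>v\<in>C i. \<gamma> v * hat d p v j) = 0) \<longrightarrow> (\<exists>c. \<forall>v\<in>C i. \<gamma> v = c * \<alpha> v))"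
proof (rule circuit_dependency[of "C i" d p])
  fix v assume "v \<in> C i"
  then show "lin_indep_family (C i - {v}) (hat d p)"
    using assms cards(3) finite_vertices(3) less_n by (intro points) auto
qed (use assms cards finite_vertices in auto)

lemma bipartite_stress:
  assumes F: "F \<subseteq> D" and c: "stress d p F c"
  obtains t \<alpha> where "\<And>a b. a \<in> A \<Longrightarrow> b \<in> B \<Longrightarrow> edge_weight F c a b = t b * \<alpha> a"
    "\<And>i. (\<Sum>b\<in>B. t b * hat d p b i) = 0" "\<And>a. a \<in> A \<Longrightarrow> \<alpha> a \<noteq> 0"
proof -
  \<comment> \<open>Any two points of \<open>A\<close> will do: \<open>F\<close> does not contain
    the edge between them, and they only serve to invoke
    \<open>stress_squares_vanish\<close>.\<close>
  obtain a1 a2 where a: "a1 \<in> A" "a2 \<in> A" "a1 \<noteq> a2"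
  proof -
    have "2 \<le> card A" using cards by simp
    then show thesis using that by (meson card_2_iff' obtain_subset_with_card_n subsetD)
  qed
  let ?\<omega> = "edge_weight F c"
  have fin: "finite A" "finite B" by (rule finite_vertices)+
  have FK: "F \<subseteq> Kn_edges n" using F D_edges by blast
  have F': "F \<subseteq> insert {a1, a2} D" using F by blast
  have split: "sum f (A \<union> B) = sum f A + sum f B" for f :: "nat \<Rightarrow> real"
    using fin AB by (rule sum.union_disjoint)
  have nb: "{u. {w, u} \<in> F} \<subseteq> A" if "w \<in> B" for w using that F D_neighbours(2) by blast
  have na: "{u. {w, u} \<in> F} \<subseteq> B" if "w \<in> A" for w using that F D_neighbours(1) by blast
  have B0: "(\<Sum>a\<in>A. ?\<omega> a b * hat d p a i) = 0" if b: "b \<in> B" for b i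
  proof -
    have "(\<Sum>u\<in>B. ?\<omega> b u) = 0" using nb[OF b] AB by (intro sum.neutral) (auto simp: edge_weight_def)
    \<comment> \<open>With total weight 0 at \<open>b\<close>, equilibrium turns into an affine
      dependency of \<open>A\<close>.\<close>
    then have "(\<Sum>u\<in>A. ?\<omega> b u) = 0"
      using stress_squares_vanish(2)[OF F' a c, of b] b by (simp add: split)
    then show ?thesis
      using stress_equilibrium[OF FK c fin(1) nb[OF b], of i] by (simp add: edge_weight_commute[of F c b])
  qed
  have A0: "(\<Sum>b\<in>B. ?\<omega> x b * hat d p b i) = 0" if x: "x \<in> A" for x i
  proof -
    have "(\<Sum>u\<in>A. ?\<omega> x u) = 0" using na[OF x] AB by (intro sum.neutral) (auto simp: edge_weight_def)
    then have "(\<Sum>u\<in>B. ?\<omega> x u) = 0"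
      using stress_squares_vanish(2)[OF F' a c, of x] x by (simp add: split)
    then show ?thesis
      using stress_equilibrium[OF FK c fin(2) na[OF x], of i] by simp
  qed
  obtain \<alpha> where \<alpha>: "\<And>v. v \<in> A \<Longrightarrow> \<alpha> v \<noteq> 0" "\<And>i. (\<Sum>v\<in>A. \<alpha> v * hat d p v i) = 0"
    "\<And>\<gamma>. (\<And>i. (\<Sum>v\<in>A. \<gamma> v * hat d p v i) = 0) \<Longrightarrow> \<exists>c. \<forall>v\<in>A. \<gamma> v = c * \<alpha> v"
    using dependency_A by blast
  have "A \<noteq> {}" using a by blast
  from rank_one_bipartite[OF this \<alpha>(1,3) B0 A0] obtain t where
    "\<forall>a\<in>A. \<forall>b\<in>B. ?\<omega> a b = t b * \<alpha> a" "\<forall>i. (\<Sum>b\<in>B. t b * hat d p b i) = 0"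
    by blast
  with \<alpha>(1) show thesis by (intro that[of t \<alpha>]) auto
qed

text \<open>The rows of the stress matrix are dependencies of \<open>C i\<close>, hence multiples of
  \<alpha>; symmetry then makes the matrix a multiple of the product of \<alpha> with
  itself.\<close>

lemma clique_stress:
  assumes i: "i < m" and F: "F \<subseteq> D" and c: "stress d p F c"
  obtains \<mu> \<alpha> where "\<And>u v. u \<in> C i \<Longrightarrow> v \<in> C i \<Longrightarrow> u \<noteq> v \<Longrightarrow> edge_weight F c u v = \<mu> * \<alpha> u * \<alpha> v"
    "\<And>u. u \<in> C i \<Longrightarrow> \<alpha> u \<noteq> 0"
proof -
  let ?\<omega> = "edge_weight F c"
  have fin: "finite (C i)" using i by (rule finite_vertices)
  have FK: "F \<subseteq> Kn_edges n" using F D_edges by blast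
  \<comment> \<open>The diagonal absorbs the total weight, so that equilibrium says that each row
    annihilates the points.\<close>
  define \<Omega> where "\<Omega> u v = (if u = v then - (\<Sum>x\<in>C i. ?\<omega> u x) else ?\<omega> u v)" for u v
  obtain \<alpha> where \<alpha>: "\<And>v. v \<in> C i \<Longrightarrow> \<alpha> v \<noteq> 0" "\<And>j. (\<Sum>v\<in>C i. \<alpha> v * hat d p v j) = 0"
    "\<And>\<gamma>. (\<And>j. (\<Sum>v\<in>C i. \<gamma> v * hat d p v j) = 0) \<Longrightarrow> \<exists>c. \<forall>v\<in>C i. \<gamma> v = c * \<alpha> v"
    using dependency_C[OF i] by blast
  have "\<exists>l. \<forall>v\<in>C i. \<Omega> u v = l * \<alpha> v" if u: "u \<in> C i" for u
  proof (rule \<alpha>(3))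
    fix j
    have N: "{v. {u, v} \<in> F} \<subseteq> C i" using D_neighbours(3)[OF _ i u] F by blast
    have "{u, u} \<notin> F" using FK Kn_edges_doubleton[of u u n] by auto
    then have uu: "?\<omega> u u = 0" by (simp add: edge_weight_def)
    have "(\<Sum>v\<in>C i. \<Omega> u v * hat d p v j) =
        (\<Sum>v\<in>C i. ?\<omega> u v * hat d p v j + (if v = u then - (\<Sum>x\<in>C i. ?\<omega> u x) * hat d p u j else 0))"
      using uu by (intro sum.cong) (auto simp: \<Omega>_def)
    also have "\<dots> = (\<Sum>v\<in>C i. ?\<omega> u v * hat d p v j) - (\<Sum>x\<in>C i. ?\<omega> u x) * hat d p u j"
      using fin u by (simp add: sum.distrib)
    also have "\<dots> = 0" using stress_equilibrium[OF FK c fin N] by simp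
    finally show "(\<Sum>v\<in>C i. \<Omega> u v * hat d p v j) = 0" .
  qed
  then obtain l where l: "\<And>u v. u \<in> C i \<Longrightarrow> v \<in> C i \<Longrightarrow> \<Omega> u v = l u * \<alpha> v" by metis
  have sym: "\<Omega> u v = \<Omega> v u" for u v by (auto simp: \<Omega>_def edge_weight_commute[of F c u])
  have "C i \<noteq> {}" using cards(3)[OF i] by auto
  then obtain w where w: "w \<in> C i" by blast
  have lw: "l u = l w / \<alpha> w * \<alpha> u" if u: "u \<in> C i" for u
    using l[OF u w] l[OF w u] sym[of u w] \<alpha>(1)[OF w] by (simp add: field_simps)
  show thesis
  proof (rule that[of "l w / \<alpha> w" \<alpha>])
    fix u v assume "u \<in> C i" "v \<in> C i" "u \<noteq> v"
    then show "?\<omega> u v = l w / \<alpha> w * \<alpha> u * \<alpha> v" using l[of u v] lw[of u] by (simp add: \<Omega>_def)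
  qed (fact \<alpha>(1))
qed

section \<open>Independent subsets of the circuit\<close>

lemma clique_dependent:
  assumes i: "i < m" and Y: "Y \<subseteq> D" "clique i \<subseteq> Y"
  shows "\<not> lin_indep_family Y (rigidity_row d p)"
proof -
  obtain \<alpha> where \<alpha>: "\<And>v. v \<in> C i \<Longrightarrow> \<alpha> v \<noteq> 0" "\<And>j. (\<Sum>v\<in>C i. \<alpha> v * hat d p v j) = 0"
    "\<And>\<gamma>. (\<And>j. (\<Sum>v\<in>C i. \<gamma> v * hat d p v j) = 0) \<Longrightarrow> \<exists>c. \<forall>v\<in>C i. \<gamma> v = c * \<alpha> v"
    using dependency_C[OF i] by blast
  obtain u v where uv: "u \<in> C i" "v \<in> C i" "u \<noteq> v"
  proof -
    have "2 \<le> card (C i)" using cards(3)[OF i] by simp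
    then show thesis using that by (meson card_2_iff' obtain_subset_with_card_n subsetD)
  qed
  show ?thesis
  proof (rule product_stress_dependent[where G = "clique i" and e = "{u, v}" and \<gamma> = \<alpha> and n = n])
    show "{u, v} \<in> clique i" using uv by (auto simp: clique_def)
    show "\<And>w. w \<in> {u, v} \<Longrightarrow> \<alpha> w \<noteq> 0" using \<alpha>(1) uv by blast
    fix w j assume w: "w \<in> \<Union>(clique i)" and j: "j < d"
    then have wC: "w \<in> C i" by (auto simp: clique_def)
    have "{u. {w, u} \<in> clique i} = C i - {w}" using wC by (auto simp: clique_def doubleton_eq_iff)
    \<comment> \<open>The missing term u = w is a zero difference, so the dependency of all of
      \<open>C i\<close> may be used.\<close>
    moreover have "(\<Sum>u\<in>C i - {w}. \<alpha> u * (p w j - p u j)) = (\<Sum>u\<in>C i. \<alpha> u * (p w j - p u j))"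
      using finite_vertices(3)[OF i] by (intro sum.mono_neutral_left) auto
    ultimately show "(\<Sum>u\<in>{u. {w, u} \<in> clique i}. \<alpha> u * (p w j - p u j)) = 0"
      using affine_dependency_differences[OF \<alpha>(2) j] by simp
  qed (use Y D_edges in auto)
qed

text \<open>The complete bipartite graph on \<open>A\<close> and \<open>S\<close> carries the
  product of the dependency of \<open>A\<close> with one of the d+2 points of
  \<open>S\<close>.\<close>

lemma stars_dependent:
  assumes Y: "Y \<subseteq> D" and S: "S \<subseteq> B" "card S = d + 2" "\<And>b. b \<in> S \<Longrightarrow> star b \<subseteq> Y"
  shows "\<not> lin_indep_family Y (rigidity_row d p)"
proof -
  obtain \<alpha> where \<alpha>: "\<And>v. v \<in> A \<Longrightarrow> \<alpha> v \<noteq> 0" "\<And>i. (\<Sum>v\<in>A. \<alpha> v * hat d p v i) = 0"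
    "\<And>\<gamma>. (\<And>i. (\<Sum>v\<in>A. \<gamma> v * hat d p v i) = 0) \<Longrightarrow> \<exists>c. \<forall>v\<in>A. \<gamma> v = c * \<alpha> v"
    using dependency_A by blast
  have fS: "finite S" using S(1) finite_vertices(2) finite_subset by blast
  then obtain \<beta> where \<beta>: "\<exists>v\<in>S. \<beta> v \<noteq> 0" "\<And>i. (\<Sum>v\<in>S. \<beta> v * hat d p v i) = 0"
    using affine_dependency_exists[of S d p] S(2) by auto
  obtain b where b: "b \<in> S" "\<beta> b \<noteq> 0" using \<beta>(1) by blast
  have "A \<noteq> {}" using cards(1) by auto
  then obtain a where a: "a \<in> A" by blast
  define \<gamma> where "\<gamma> v = (if v \<in> A then \<alpha> v else \<beta> v)" for v
  let ?G = "\<Union>b\<in>S. star b"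
  have SA: "v \<notin> A" if "v \<in> S" for v using that S(1) AB by blast
  have \<gamma>A: "(\<Sum>v\<in>A. \<gamma> v * hat d p v i) = 0" for i
    using \<alpha>(2)[of i] by (simp add: \<gamma>_def cong: sum.cong)
  have \<gamma>S: "(\<Sum>v\<in>S. \<gamma> v * hat d p v i) = 0" for i
    using \<beta>(2)[of i] SA by (simp add: \<gamma>_def cong: sum.cong)
  show ?thesis
  proof (rule product_stress_dependent[where G = ?G and e = "{a, b}" and \<gamma> = \<gamma> and n = n])
    show "{a, b} \<in> ?G" using a b by (auto simp: star_def)
    show "\<And>w. w \<in> {a, b} \<Longrightarrow> \<gamma> w \<noteq> 0" using \<alpha>(1) a b SA by (auto simp: \<gamma>_def)
    fix w j assume w: "w \<in> \<Union>?G" and j: "j < d"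
    then consider "w \<in> A" | "w \<in> S" by (auto simp: star_def)
    then show "(\<Sum>u\<in>{u. {w, u} \<in> ?G}. \<gamma> u * (p w j - p u j)) = 0"
    proof cases
      case 1
      then have "{u. {w, u} \<in> ?G} = S" using SA by (auto simp: star_def doubleton_eq_iff)
      then show ?thesis using affine_dependency_differences[OF \<gamma>S j] by simp
    next
      case 2
      then have "{u. {w, u} \<in> ?G} = A" using SA by (auto simp: star_def doubleton_eq_iff)
      then show ?thesis using affine_dependency_differences[OF \<gamma>A j] by simp
    qed
  qed (use Y S D_edges in auto)
qed

text \<open>By the product form of the stresses, an edge missing from the star of b forces t b = 0.
  Two broken stars leave at most d+1 points of \<open>B\<close>, which are independent, so t
  vanishes. Likewise one edge missing from a clique kills its single scalar, since \<alpha> has no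
  zeros.\<close>

lemma independent_iff:
  assumes Y: "Y \<subseteq> D"
  shows "lin_indep_family Y (rigidity_row d p) \<longleftrightarrow>
    2 \<le> card {b\<in>B. \<not> star b \<subseteq> Y} \<and> (\<forall>i<m. \<not> clique i \<subseteq> Y)"
proof
  assume ind: "lin_indep_family Y (rigidity_row d p)"
  have "2 \<le> card {b\<in>B. \<not> star b \<subseteq> Y}"
  proof (rule ccontr)
    assume "\<not> ?thesis"
    moreover have "card {b\<in>B. \<not> star b \<subseteq> Y} + card {b\<in>B. star b \<subseteq> Y} = card B"
      using finite_vertices(2)
      by (subst card_Un_disjoint[symmetric]) (auto intro: arg_cong[where f = card])
    \<comment> \<open>At most one of the d+3 stars is broken, so d+2 complete ones remain.\<close>
    ultimately have "d + 2 \<le> card {b\<in>B. star b \<subseteq> Y}" using cards(2) by linarith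
    then obtain S where "S \<subseteq> {b\<in>B. star b \<subseteq> Y}" "card S = d + 2"
      by (meson obtain_subset_with_card_n)
    then show False using stars_dependent[OF Y, of S] ind by blast
  qed
  then show "2 \<le> card {b\<in>B. \<not> star b \<subseteq> Y} \<and> (\<forall>i<m. \<not> clique i \<subseteq> Y)"
    using clique_dependent[OF _ Y] ind by blast
next
  assume R: "2 \<le> card {b\<in>B. \<not> star b \<subseteq> Y} \<and> (\<forall>i<m. \<not> clique i \<subseteq> Y)"
  show "lin_indep_family Y (rigidity_row d p)"
  proof (rule lin_indep_familyI)
    fix c e assume "\<And>i. (\<Sum>e\<in>Y. c e * rigidity_row d p e i) = 0" and e: "e \<in> Y"
    then have c: "stress d p Y c" by (simp add: stress_def)
    let ?\<omega> = "edge_weight Y c"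
    have ce: "c {u, v} = ?\<omega> u v" if "{u, v} \<in> Y" for u v using that by (simp add: edge_weight_def)
    from e Y consider a b where "a \<in> A" "b \<in> B" "e = {a, b}"
      | i u v where "i < m" "u \<in> C i" "v \<in> C i" "u \<noteq> v" "e = {u, v}"
      unfolding D_def star_def clique_def by blast
    then show "c e = 0"
    proof cases
      case (1 a b)
      obtain t \<alpha> where t: "\<And>a b. a \<in> A \<Longrightarrow> b \<in> B \<Longrightarrow> ?\<omega> a b = t b * \<alpha> a"
        "\<And>i. (\<Sum>b\<in>B. t b * hat d p b i) = 0" "\<And>a. a \<in> A \<Longrightarrow> \<alpha> a \<noteq> 0"
        using bipartite_stress[OF Y c] by blast
      have miss: "t b' = 0" if b': "b' \<in> B" "\<not> star b' \<subseteq> Y" for b'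
      proof -
        obtain a' where a': "a' \<in> A" "{a', b'} \<notin> Y" using b'(2) by (auto simp: star_def)
        then have "?\<omega> a' b' = 0" by (simp add: edge_weight_def)
        then show ?thesis using t(1)[OF a'(1) b'(1)] t(3)[OF a'(1)] by simp
      qed
      let ?Z = "{b\<in>B. \<not> star b \<subseteq> Y}"
      have "card (B - ?Z) = card B - card ?Z"
        using finite_vertices(2) by (intro card_Diff_subset) auto
      then have "card (B - ?Z) \<le> d + 1" using R cards(2) by linarith
      then have indZ: "lin_indep_family (B - ?Z) (hat d p)" using less_n(2) by (intro points) auto
      have "(\<Sum>b\<in>B - ?Z. t b * hat d p b i) = 0" for i
      proof -
        have "(\<Sum>b\<in>B - ?Z. t b * hat d p b i) = (\<Sum>b\<in>B. t b * hat d p b i)"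
          using finite_vertices(2) miss by (intro sum.mono_neutral_left) auto
        then show ?thesis using t(2) by simp
      qed
      from lin_indep_familyD[OF indZ this, of b] have "t b = 0" if "b \<in> B - ?Z" using that by blast
      then have "t b = 0" using miss 1(2) by blast
      then show ?thesis using t(1)[OF 1(1,2)] ce[of a b] e 1(3) by simp
    next
      case (2 i u v)
      obtain \<mu> \<alpha> where \<mu>: "\<And>u v. u \<in> C i \<Longrightarrow> v \<in> C i \<Longrightarrow> u \<noteq> v \<Longrightarrow> ?\<omega> u v = \<mu> * \<alpha> u * \<alpha> v"
        "\<And>u. u \<in> C i \<Longrightarrow> \<alpha> u \<noteq> 0"
        using clique_stress[OF 2(1) Y c] by blast
      obtain x y where xy: "x \<in> C i" "y \<in> C i" "x \<noteq> y" "{x, y} \<notin> Y"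
        using R 2(1) unfolding clique_def by blast
      then have "?\<omega> x y = 0" by (simp add: edge_weight_def)
      then have "\<mu> = 0" using \<mu>(1)[OF xy(1-3)] \<mu>(2) xy by auto
      then show ?thesis using \<mu>(1)[OF 2(2-4)] ce[of u v] e 2(5) by simp
    qed
  qed
qed

section \<open>The rank function on subsets of the circuit\<close>

lemma part_simps [simp]: "part (Inl b) = star b" "part (Inr i) = clique i"
  by (simp_all add: part_def)

lemma D_parts: "D = (\<Union>q\<in>Inl ` B \<union> Inr ` {..<m}. part q)"
  by (simp add: D_def image_Un UN_extend_simps(10))

lemma part_nonempty: "q \<in> Inl ` B \<union> Inr ` {..<m} \<Longrightarrow> part q \<noteq> {}"
proof (elim UnE imageE)
  fix b assume "q = Inl b"
  moreover have "A \<noteq> {}" using cards(1) by auto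
  ultimately show ?thesis by (simp add: star_def)
next
  fix i assume i: "q = Inr i" "i \<in> {..<m}"
  then have "\<not> card (C i) \<le> Suc 0" "finite (C i)" using cards(3)[of i] finite_vertices(3)[of i] by auto
  then obtain u v where "u \<in> C i" "v \<in> C i" "u \<noteq> v" by (auto simp: card_le_Suc0_iff_eq)
  then show ?thesis using i by (auto simp: clique_def)
qed

lemma part_disjoint:
  assumes "q \<in> Inl ` B \<union> Inr ` {..<m}" "q' \<in> Inl ` B \<union> Inr ` {..<m}" "q \<noteq> q'"
  shows "part q \<inter> part q' = {}"
proof -
  have star: "e \<inter> B = {b}" "\<exists>a\<in>A. a \<in> e" if "e \<in> star b" "b \<in> B" for e b
    using that AB by (auto simp: star_def)
  have clique: "e \<subseteq> C i" "e \<noteq> {}" if "e \<in> clique i" for e i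
    using that by (auto simp: clique_def)
  have False if e: "e \<in> part q" "e \<in> part q'" for e
    using assms
  proof (elim UnE imageE)
    fix b b' assume "q = Inl b" "b \<in> B" "q' = Inl b'" "b' \<in> B" "q \<noteq> q'"
    then show False using e star(1)[of e b] star(1)[of e b'] by auto
  next
    fix b i assume "q = Inl b" "b \<in> B" "q' = Inr i" "i \<in> {..<m}"
    then show False using e star(1)[of e b] clique(1)[of e i] BC[of i] by auto
  next
    fix b i assume "q' = Inl b" "b \<in> B" "q = Inr i" "i \<in> {..<m}"
    then show False using e star(1)[of e b] clique(1)[of e i] BC[of i] by auto
  next
    fix i j assume "q = Inr i" "i \<in> {..<m}" "q' = Inr j" "j \<in> {..<m}" "q \<noteq> q'"
    then show False using e clique[of e i] clique(1)[of e j] CC[of i j] by auto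
  qed
  then show ?thesis by blast
qed

lemma row_rank_nullity:
  assumes "X \<subseteq> D"
  shows "row_rank d p X + ((2 - card {q\<in>Inl ` B. \<not> part q \<subseteq> X}) + card {q\<in>Inr ` {..<m}. part q \<subseteq> X})
    = card X"
  unfolding row_rank_def
proof (rule Max_card_partition)
  show "finite X" using assms finite_D finite_subset by blast
  show "finite (Inl ` B)" using finite_vertices by simp
  show "2 \<le> card (Inl ` B)" using cards(2) by (simp add: card_image)
  fix Y assume "Y \<subseteq> X"
  then have Y: "Y \<subseteq> D" using assms by blast
  have "{q\<in>Inl ` B. \<not> part q \<subseteq> Y} = Inl ` {b\<in>B. \<not> star b \<subseteq> Y}" by (auto simp: image_iff)
  then have "card {q\<in>Inl ` B. \<not> part q \<subseteq> Y} = card {b\<in>B. \<not> star b \<subseteq> Y}" by (simp add: card_image)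
  then show "lin_indep_family Y (rigidity_row d p) \<longleftrightarrow>
      2 \<le> card {q\<in>Inl ` B. \<not> part q \<subseteq> Y} \<and> (\<forall>q\<in>Inr ` {..<m}. \<not> part q \<subseteq> Y)"
    using independent_iff[OF Y] by auto
next
  show "part q \<noteq> {}" if "q \<in> Inl ` B \<union> Inr ` {..<m}" for q
    using that by (rule part_nonempty)
  show "part q \<inter> part q' = {}"
    if "q \<in> Inl ` B \<union> Inr ` {..<m}" "q' \<in> Inl ` B \<union> Inr ` {..<m}" "q \<noteq> q'" for q q'
    using that by (rule part_disjoint)
qed auto

section \<open>Closures and the failure of balance\<close>

lemma edge_outside_closure:
  assumes x: "x \<in> Kn_edges n"
  shows "\<exists>q\<in>Inl ` B \<union> Inr ` {..<m}. row_rank d p (insert x (D - part q)) \<noteq> row_rank d p (D - part q)"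
proof -
  have fin: "finite (D - part q)" for q using finite_D by simp
  \<comment> \<open>No edge of \<open>X\<close> meets \<open>u\<close>, so the new edge hangs there;
    \<open>d_pos\<close> brings two points within the range of \<open>points\<close>.\<close>
  have pendant: "row_rank d p (insert {u, v} X) \<noteq> row_rank d p X"
    if uv: "{u, v} \<in> Kn_edges n" and X: "X \<subseteq> D" "\<And>e. e \<in> X \<Longrightarrow> u \<notin> e" for u v X
  proof (rule row_rank_insert)
    show "finite X" using X(1) finite_D finite_subset by blast
    show "{u, v} \<notin> X" using X(2) by blast
    have "card {u, v} \<le> d + 1" using d_pos by (cases "u = v") auto
    then have ind: "lin_indep_family {u, v} (hat d p)"
      using uv by (intro points) (auto simp: Kn_edges_doubleton)
    have sub: "insert {u, v} X \<subseteq> Kn_edges n" using uv X(1) D_edges by blast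
    show "c {u, v} = 0" if "stress d p (insert {u, v} X) c" for c
      using stress_pendant_edge[OF sub X(2) ind that] by blast
  qed
  have endpoint: ?thesis if uv: "x = {u, v}" and u: "u \<notin> A" for u v
  proof -
    have "u < n" using x uv by (simp add: Kn_edges_doubleton)
    then consider "u \<in> B" | i where "i < m" "u \<in> C i" using u vertices by blast
    then show ?thesis
    proof cases
      case 1
      \<comment> \<open>Without its star the vertex \<open>u\<close> is isolated, also when
        \<open>x\<close> was itself an edge of that star.\<close>
      have "u \<notin> e" if e: "e \<in> D - star u" for e
      proof
        assume ue: "u \<in> e"
        from e consider a b where "a \<in> A" "b \<in> B" "e = {a, b}" | i where "i < m" "e \<in> clique i"
          unfolding D_def star_def by blast
        then show False
        proof cases
          case (1 a b)
          then have "b = u" using ue u by auto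
          then show False using e 1 by (auto simp: star_def)
        next
          case (2 i)
          then have "u \<in> C i" using ue by (auto simp: clique_def)
          then show False using BC[OF 2(1)] \<open>u \<in> B\<close> by blast
        qed
      qed
      then have "row_rank d p (insert x (D - star u)) \<noteq> row_rank d p (D - star u)"
        using pendant[of u v "D - star u"] x uv by blast
      then show ?thesis using 1 by (intro bexI[of _ "Inl u"]) auto
    next
      case (2 i)
      have "u \<notin> e" if e: "e \<in> D - clique i" for e
      proof
        assume ue: "u \<in> e"
        have "u \<notin> B" using BC[OF 2(1)] 2(2) by blast
        with e ue u obtain j where j: "j < m" "e \<in> clique j"
          unfolding D_def star_def by blast
        then have "u \<in> C j" using ue by (auto simp: clique_def)
        then have "i = j" using CC[OF 2(1) j(1)] 2(2) by blast
        then show False using e j by blast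
      qed
      then have "row_rank d p (insert x (D - clique i)) \<noteq> row_rank d p (D - clique i)"
        using pendant[of u v "D - clique i"] x uv by blast
      then show ?thesis using 2 by (intro bexI[of _ "Inr i"]) auto
    qed
  qed
  obtain u v where uv: "x = {u, v}" "u \<noteq> v" using x by (auto simp: Kn_edges_def)
  show ?thesis
  proof (cases "u \<in> A \<and> v \<in> A")
    case True
    have "x \<notin> D"
    proof
      assume "x \<in> D"
      then have "v \<in> B" using D_neighbours(1)[of u v] uv(1) True by blast
      then show False using True AB by blast
    qed
    have "B \<noteq> {}" using cards(2) by auto
    \<comment> \<open>Any part would do for an edge inside \<open>A\<close>, since it carries no
      stress even together with all of \<open>D\<close>.\<close>
    then obtain b where b: "b \<in> B" by blast
    have "row_rank d p (insert x (D - star b)) \<noteq> row_rank d p (D - star b)"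
    proof (rule row_rank_insert)
      fix c assume c: "stress d p (insert x (D - star b)) c"
      have "insert x (D - star b) \<subseteq> insert {u, v} D" using uv by blast
      from stress_zero_on_A_edge[OF this _ _ uv(2) c] show "c x = 0" using True uv by simp
    qed (use \<open>x \<notin> D\<close> finite_D in auto)
    then show ?thesis using b by (intro bexI[of _ "Inl b"]) auto
  next
    case False
    then show ?thesis using endpoint[of u v] endpoint[of v u] uv by (auto simp: insert_commute)
  qed
qed

lemma unbalanced_circuit:
  "kfold_circuit (row_rank d p) (Kn_edges n) (m + 2) D"
  "\<not> balanced (row_rank d p) (Kn_edges n) (m + 2) D"
proof -
  let ?J = "Inl ` B :: (nat + nat) set" and ?K = "Inr ` {..<m} :: (nat + nat) set"
  let ?P = "part ` (?J \<union> ?K)"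
  have "card ?K = m" "card ?J = d + 3" using cards(2) by (simp_all add: card_image)
  note cJK = this
  have fin: "finite ?J" "finite ?K" "?J \<inter> ?K = {}" using finite_vertices by auto
  note k = kfold_circuit_partition[OF finite_D fin part_disjoint part_nonempty D_parts D_edges
      row_rank_nullity, unfolded cJK]
  show "kfold_circuit (row_rank d p) (Kn_edges n) (m + 2) D" by (rule k(1))
  \<comment> \<open>An intersection over an empty family would be the universe rather than a set of
    edges.\<close>
  have ne: "?P \<noteq> {}" using cards(2) by auto
  have "(\<Inter>P\<in>?P. mclosure (row_rank d p) (Kn_edges n) (D - P)) = {}"
  proof (rule equals0I)
    fix x assume x: "x \<in> (\<Inter>P\<in>?P. mclosure (row_rank d p) (Kn_edges n) (D - P))"
    then have "x \<in> Kn_edges n" using ne by (auto simp: mclosure_def)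
    from edge_outside_closure[OF this] obtain q where
      "q \<in> ?J \<union> ?K" "row_rank d p (insert x (D - part q)) \<noteq> row_rank d p (D - part q)" by blast
    then show False using x by (auto simp: mclosure_def simp del: part_simps)
  qed
  \<comment> \<open>Balance would require the rank (d + 3 + m) - (m + 2) = d + 1 instead.\<close>
  moreover have "row_rank d p {} = 0" using row_rank_nullity[of "{}"] by simp
  ultimately show "\<not> balanced (row_rank d p) (Kn_edges n) (m + 2) D"
    using k(2,3) unfolding balanced_def by auto
qed

end

section \<open>Placing the circuit in a complete graph\<close>

theorem theorem3p7:
  fixes d k :: nat
  assumes "d \<ge> 4" and "k \<ge> 2"
  shows "\<exists>n > 0. \<exists>D.
           kfold_circuit (generic_rigidity_rank d n) (Kn_edges n) k D \<and>
           \<not> balanced (generic_rigidity_rank d n) (Kn_edges n) k D"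
proof -
  define m where "m = k - 2"
  define n where "n = 2 * d + 5 + m * (d + 2)"
  \<comment> \<open>The very choice made in \<open>generic_rigidity_rank\<close>, so that both rank
    functions coincide.\<close>
  define p where "p = (SOME p. generic_config d n p)"
  have p: "generic_config d n p"
    unfolding p_def using generic_config_exists by (rule someI_ex)
  define A where "A = {..<d + 2}"
  define B where "B = {d + 2..<2 * d + 5}"
  define C where "C i = {2 * d + 5 + i * (d + 2)..<2 * d + 5 + (i + 1) * (d + 2)}" for i
  have V: "{..<n} = A \<union> B \<union> (\<Union>i<m. C i)"
  proof -
    have "(\<Union>i<m. C i) = {2 * d + 5..<n}"
      unfolding n_def
    proof (induction m)
      case (Suc m)
      then show ?case by (auto simp: lessThan_Suc C_def)
    qed simp
    then show ?thesis by (auto simp: A_def B_def n_def)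
  qed
  have CC: "C i \<inter> C j = {}" if "i < j" for i j
  proof -
    have "(i + 1) * (d + 2) \<le> j * (d + 2)" using that by (intro mult_le_mono1) simp
    then show ?thesis unfolding C_def by auto
  qed
  interpret bipartite_and_cliques d n m p A B C
  proof
    show "C i \<inter> C j = {}" if "i < m" "j < m" "i \<noteq> j" for i j
      using CC[of i j] CC[of j i] that(3) by (cases "i < j") auto
    show "lin_indep_family S (hat d p)" if "S \<subseteq> {..<n}" "card S \<le> d + 1" for S
      using generic_hat_independent[OF p that] .
    \<comment> \<open>The cliques take no part in the relation between squares, so the bound does
      not grow with \<open>k\<close>.\<close>
    have "A \<union> B \<subseteq> {..<n}" "card (A \<union> B) \<le> 2 * d + 5"
      using V card_Un_le[of A B] by (auto simp: A_def B_def)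
    then show "lin_indep_family (Id_on (A \<union> B) \<union> {(a, b)}) (sym_prod d p)"
      if "a \<in> A" "b \<in> A" "a \<noteq> b" for a b
      using generic_sym_prod_independent[OF p _ _ assms(1), of "A \<union> B" a b] that by blast
    show "{..<n} = A \<union> B \<union> (\<Union>i<m. C i)" by (rule V)
    show "card (C i) = d + 2" for i by (simp add: C_def)
  qed (use assms in \<open>auto simp: A_def B_def C_def\<close>)
  have "generic_rigidity_rank d n = row_rank d p" by (simp add: generic_rigidity_rank_def p_def)
  moreover have "k = m + 2" using assms(2) by (simp add: m_def)
  moreover have "n > 0" by (simp add: n_def)
  ultimately show ?thesis
    using unbalanced_circuit by (intro exI[of _ n] conjI exI[of _ D]) simp_all
qed

end
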